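(* Let $\Delta\ge 1$ be an integer and let $V$ be a vertex set with $|V|=n\ge \Delta+1$. Write $n=a(2\Delta-1)+b$ and $b(\Delta-1)=k_1(2\Delta-1)+k_2$, where $a,b,k_1,k_2$ are nonnegative integers with $0\le b\le 2\Delta-2$ and $0\le k_2\le 2\Delta-2$. Then the maximum value of $|\mathcal{S}|$, taken over all collections $\mathcal{S}$ of stars $K_{1,\Delta}$ on $V$ that are rainbow $K_{1,\Delta}$-free, equals $$\begin{cases} a(\Delta-1)^2+k_1(\Delta-1), & \text{if } a\ge 1 \text{ and } 0\le k_2\le \Delta;\\ a(\Delta-1)^2+k_1(\Delta-1)+k_2-\Delta, & \text{if } a\ge 1 \text{ and } \Delta\le k_2\le 2\Delta-2;\\ \left\lfloor \frac{(n-1)^2}{4}\right\rfloor, & \text{if } a=0.\end{cases}$$ Moreover, these bounds are attained, and the set of all rainbow $K_{1,\Delta}$-free collections $\mathcal{S}$ of stars $K_{1,\Delta}$ on $V$ with $|\mathcal{S}|$ equal to this maximum is exactly $\mathfrak{A}(n,\Delta)$ (defined in the context).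
   Context: A collection of graphs on $V$ is a finite family (multiset; members need not be distinct) of graphs whose vertex sets are subsets of $V$. A "star $K_{1,\Delta}$ on $V$" is a subgraph isomorphic to $K_{1,\Delta}$ with vertices in $V$; its center is the vertex of degree $\Delta$ and the other vertices are its leaves. A collection $\mathcal{G}=\{G_1,\dots,G_t\}$ contains a rainbow $H$ if there is a graph isomorphic to $H$ whose edges can be assigned injectively to indices $i$ so that each edge lies in the assigned $G_i$ (i.e. at most one edge is taken from each $G_i$); $\mathcal{G}$ is rainbow $H$-free otherwise. For a collection $\mathcal{S}$ of stars $K_{1,\Delta}$ on $V$: $\mathcal{S}_u$ denotes the subcollection of stars with center $u$; $C=\{u\in V:\mathcal{S}_u\ne\emptyset\}$ and $L=V\setminus C$; $\overrightarrow{D}$ is the digraph with vertex set $V$ and arc set $\{(x,y): xy \text{ is an edge of some star in } \mathcal{S}_x\}$; $d^-_{\overrightarrow{D}}(v)$, $d^+_{\overrightarrow{D}}(v)$ are in- and out-degrees, $\overrightarrow{D}[C]$ is the subdigraph induced by $C$ and $A(\overrightarrow{D}[C])$ its arc set; a digraph is $d$-out-regular if every vertex has out-degree $d$. With $n,\Delta,a,b,k_1,k_2$ as in the claim, $\mathfrak{A}(n,\Delta)$ is the set of collections $\mathcal{S}$ of stars $K_{1,\Delta}$ on $V$ satisfying: (i) if $n\ge 2\Delta-1$ and $k_2<\Delta$: $|\mathcal{S}|=a(\Delta-1)^2+k_1(\Delta-1)$; $|C|=a(\Delta-1)+k_1$; each $u\in C$ is the center of exactly $\Delta-1$ stars of $\mathcal{S}$,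 and all leaves of these stars lie in $L$; and $d^-_{\overrightarrow{D}}(v)\le\Delta-1$ for every $v\in L$. (ii) if $n\ge 2\Delta-1$ and $k_2>\Delta$: $|\mathcal{S}|=a(\Delta-1)^2+k_1(\Delta-1)+k_2-\Delta$; $|C|=a(\Delta-1)+k_1+1$ and $|A(\overrightarrow{D}[C])|=2\Delta-1-k_2$; each $u\in C$ is the center of exactly $\Delta-1-d^-_{\overrightarrow{D}}(u)$ stars (copies of $K_{1,\Delta}$) of $\mathcal{S}$; and $d^-_{\overrightarrow{D}}(v)=\Delta-1$ for every $v\in L$. (iii) if $n\ge 2\Delta-1$ and $k_2=\Delta$: $|\mathcal{S}|=a(\Delta-1)^2+k_1(\Delta-1)$ and $\mathcal{S}$ satisfies the (remaining) conditions of (i) or of (ii). (iv) if $\Delta+1\le n\le 2\Delta-2$: $|\mathcal{S}|=\lfloor (n-1)^2/4\rfloor$; if $n$ is odd then $|C|=\lfloor (n-1)/2\rfloor$, and if $n$ is even then $|C|\in\{\lfloor (n-1)/2\rfloor,\lceil (n-1)/2\rceil\}$; $\overrightarrow{D}[C]$ is $(\Delta-|L|)$-out-regular; and for each $u\in C$, $\mathcal{S}_u$ consists of $\Delta-1-d^-_{\overrightarrow{D}}(u)$ copies of $K_{1,\Delta}$, and $L$ is contained in the leaf set of each star of $\mathcal{S}_u$. *)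

theory Defs
  imports "HOL-Library.Multiset" "Graph_Theory.Digraph_Component" Complex_Main
begin

record 'a ugraph =
  uverts :: "'a set"
  uedges :: "'a set set"

definition wf_ugraph :: "'a ugraph \<Rightarrow> bool" where
  "wf_ugraph G \<longleftrightarrow> finite (uverts G) \<and> (\<forall>e \<in> uedges G. e \<subseteq> uverts G \<and> card e = 2)"

definition udegree :: "'a ugraph \<Rightarrow> 'a \<Rightarrow> nat" where
  "udegree G v = card {e \<in> uedges G. v \<in> e}"

definition ugraph_isomorphic :: "'a ugraph \<Rightarrow> 'b ugraph \<Rightarrow> bool" where
  "ugraph_isomorphic G H \<longleftrightarrow>
     (\<exists>f. bij_betw f (uverts G) (uverts H) \<and> uedges H = (\<lambda>e. f ` e) ` uedges G)"

text \<open>The complete bipartite graph with parts of sizes 1 and \<open>d\<close>; the part of size 1 is \<open>{0}\<close>.\<close>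

definition K1 :: "nat \<Rightarrow> nat ugraph" where
  "K1 d = \<lparr> uverts = {0..d}, uedges = {{0, i} | i. i \<in> {1..d}} \<rparr>"

text \<open>
  A collection of graphs is a finite multiset. It contains a rainbow \<open>H\<close> if, for some indexing
  \<open>Gs\<close> of its members, the edges of a copy \<open>F\<close> of \<open>H\<close> can be assigned injectively to
  indices; repeated members have distinct indices. The choice of the indexing is immaterial.
\<close>

definition contains_rainbow :: "'a ugraph multiset \<Rightarrow> 'b ugraph \<Rightarrow> bool" where
  "contains_rainbow \<G> H \<longleftrightarrow>
     (\<exists>Gs F \<phi>. mset Gs = \<G> \<and> wf_ugraph F \<and> ugraph_isomorphic F H \<and>
        inj_on \<phi> (uedges F) \<and>
        (\<forall>e \<in> uedges F. \<phi> e < length Gs \<and> e \<in> uedges (Gs ! \<phi> e)))"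

abbreviation rainbow_free :: "'a ugraph multiset \<Rightarrow> 'b ugraph \<Rightarrow> bool" where
  "rainbow_free \<G> H \<equiv> \<not> contains_rainbow \<G> H"

definition star_on :: "'a set \<Rightarrow> nat \<Rightarrow> 'a ugraph \<Rightarrow> bool" where
  "star_on V \<Delta> G \<longleftrightarrow> wf_ugraph G \<and> uverts G \<subseteq> V \<and> ugraph_isomorphic G (K1 \<Delta>)"

text \<open>
  The center is unique only for \<open>\<Delta> \<ge> 2\<close>: for \<open>\<Delta> = 1\<close> both ends of the edge have
  degree \<open>\<Delta>\<close>. Leaves are therefore taken with respect to a given center.
\<close>

definition is_center :: "nat \<Rightarrow> 'a ugraph \<Rightarrow> 'a \<Rightarrow> bool" where
  "is_center \<Delta> G u \<longleftrightarrow> u \<in> uverts G \<and> udegree G u = \<Delta>"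

definition star_leaves :: "'a ugraph \<Rightarrow> 'a \<Rightarrow> 'a set" where
  "star_leaves G u = uverts G - {u}"

definition star_collections :: "'a set \<Rightarrow> nat \<Rightarrow> 'a ugraph multiset set" where
  "star_collections V \<Delta> = {\<S>. \<forall>G \<in># \<S>. star_on V \<Delta> G}"

definition stars_at :: "nat \<Rightarrow> 'a ugraph multiset \<Rightarrow> 'a \<Rightarrow> 'a ugraph multiset" where
  "stars_at \<Delta> \<S> u = filter_mset (\<lambda>G. is_center \<Delta> G u) \<S>"

definition centers :: "'a set \<Rightarrow> nat \<Rightarrow> 'a ugraph multiset \<Rightarrow> 'a set" where
  "centers V \<Delta> \<S> = {u \<in> V. stars_at \<Delta> \<S> u \<noteq> {#}}"

definition noncenters :: "'a set \<Rightarrow> nat \<Rightarrow> 'a ugraph multiset \<Rightarrow> 'a set" where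
  "noncenters V \<Delta> \<S> = V - centers V \<Delta> \<S>"

definition star_digraph ::
    "'a set \<Rightarrow> nat \<Rightarrow> 'a ugraph multiset \<Rightarrow> ('a, 'a \<times> 'a) pre_digraph" where
  "star_digraph V \<Delta> \<S> =
     \<lparr> verts = V, arcs = {(x, y). \<exists>G \<in># stars_at \<Delta> \<S> x. {x, y} \<in> uedges G},
       tail = fst, head = snd \<rparr>"

text \<open>The degree \<open>d\<close> is an integer so that it may be given as an untruncated difference.\<close>

definition out_regular :: "int \<Rightarrow> ('a, 'b) pre_digraph \<Rightarrow> bool" where
  "out_regular d D \<longleftrightarrow> (\<forall>v \<in> verts D. int (out_degree D v) = d)"

text \<open>
  The conditions below leave out the prescribed value of \<open>|\<S>|\<close>, which is imposed in
  \<open>extremal_collections\<close>.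
\<close>

definition floor_structure ::
    "'a set \<Rightarrow> nat \<Rightarrow> nat \<Rightarrow> nat \<Rightarrow> 'a ugraph multiset \<Rightarrow> bool" where
  "floor_structure V \<Delta> a k1 \<S> \<longleftrightarrow>
     (let C = centers V \<Delta> \<S>; L = noncenters V \<Delta> \<S>; D = star_digraph V \<Delta> \<S> in
        card C = a * (\<Delta> - 1) + k1 \<and>
        (\<forall>u \<in> C. size (stars_at \<Delta> \<S> u) = \<Delta> - 1 \<and>
                 (\<forall>G \<in># stars_at \<Delta> \<S> u. star_leaves G u \<subseteq> L)) \<and>
        (\<forall>v \<in> L. in_degree D v \<le> \<Delta> - 1))"

definition ceiling_structure ::
    "'a set \<Rightarrow> nat \<Rightarrow> nat \<Rightarrow> nat \<Rightarrow> nat \<Rightarrow> 'a ugraph multiset \<Rightarrow> bool" where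
  "ceiling_structure V \<Delta> a k1 k2 \<S> \<longleftrightarrow>
     (let C = centers V \<Delta> \<S>; L = noncenters V \<Delta> \<S>; D = star_digraph V \<Delta> \<S> in
        card C = a * (\<Delta> - 1) + k1 + 1 \<and>
        int (card (arcs (D \<restriction> C))) = 2 * int \<Delta> - 1 - int k2 \<and>
        (\<forall>u \<in> C. int (size (stars_at \<Delta> \<S> u)) = int \<Delta> - 1 - int (in_degree D u)) \<and>
        (\<forall>v \<in> L. in_degree D v = \<Delta> - 1))"

definition small_structure :: "'a set \<Rightarrow> nat \<Rightarrow> 'a ugraph multiset \<Rightarrow> bool" where
  "small_structure V \<Delta> \<S> \<longleftrightarrow>
     (let n = card V; C = centers V \<Delta> \<S>; L = noncenters V \<Delta> \<S>; D = star_digraph V \<Delta> \<S> in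
        (odd n \<longrightarrow> int (card C) = \<lfloor>(real n - 1) / 2\<rfloor>) \<and>
        (even n \<longrightarrow> int (card C) \<in> {\<lfloor>(real n - 1) / 2\<rfloor>, \<lceil>(real n - 1) / 2\<rceil>}) \<and>
        out_regular (int \<Delta> - int (card L)) (D \<restriction> C) \<and>
        (\<forall>u \<in> C. int (size (stars_at \<Delta> \<S> u)) = int \<Delta> - 1 - int (in_degree D u) \<and>
                 (\<forall>G \<in># stars_at \<Delta> \<S> u. L \<subseteq> star_leaves G u)))"

definition extremal_collections ::
    "'a set \<Rightarrow> nat \<Rightarrow> nat \<Rightarrow> nat \<Rightarrow> nat \<Rightarrow> 'a ugraph multiset set" where
  "extremal_collections V \<Delta> a k1 k2 =
     {\<S> \<in> star_collections V \<Delta>.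
        (card V \<ge> 2 * \<Delta> - 1 \<and> k2 < \<Delta> \<longrightarrow>
           size \<S> = a * (\<Delta> - 1)^2 + k1 * (\<Delta> - 1) \<and> floor_structure V \<Delta> a k1 \<S>) \<and>
        (card V \<ge> 2 * \<Delta> - 1 \<and> k2 > \<Delta> \<longrightarrow>
           size \<S> = a * (\<Delta> - 1)^2 + k1 * (\<Delta> - 1) + k2 - \<Delta> \<and> ceiling_structure V \<Delta> a k1 k2 \<S>) \<and>
        (card V \<ge> 2 * \<Delta> - 1 \<and> k2 = \<Delta> \<longrightarrow>
           size \<S> = a * (\<Delta> - 1)^2 + k1 * (\<Delta> - 1) \<and>
           (floor_structure V \<Delta> a k1 \<S> \<or> ceiling_structure V \<Delta> a k1 k2 \<S>)) \<and>
        (\<Delta> + 1 \<le> card V \<and> card V \<le> 2 * \<Delta> - 2 \<longrightarrow>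
           size \<S> = (card V - 1)^2 div 4 \<and> small_structure V \<Delta> \<S>)}"

definition rainbow_free_star_collections :: "'a set \<Rightarrow> nat \<Rightarrow> 'a ugraph multiset set" where
  "rainbow_free_star_collections V \<Delta> =
     {\<S> \<in> star_collections V \<Delta>. rainbow_free \<S> (K1 \<Delta>)}"

definition is_max_size :: "'a set \<Rightarrow> nat \<Rightarrow> nat \<Rightarrow> bool" where
  "is_max_size V \<Delta> m \<longleftrightarrow>
     (\<exists>\<S> \<in> rainbow_free_star_collections V \<Delta>. size \<S> = m) \<and>
     (\<forall>\<S> \<in> rainbow_free_star_collections V \<Delta>. size \<S> \<le> m)"

end

theory Submission
  imports Defs
begin

text \<open>
  Let $m(u)$ be the number of stars with center $u$. For $\Delta \ge 2$ a rainbow star centered at $v$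
  can be chosen greedily, first along the in-arcs of $v$ and then from the stars centered at $v$, so
  being rainbow free means $m(v) + d^-(v) \le \Delta - 1$ for all $v$. Write $c = |C|$ and $l = |L|$.
  Every center has out-degree at least $\Delta$, hence at least $\Delta - l$ within $C$, and double
  counting of arcs gives
  $|\mathcal{S}| \le \min\{c(\Delta-1),\, n(\Delta-1) - c\Delta,\, c(l-1)\}$,
  where each deficit is a sum of nonnegative slacks. The first two bounds cross at
  $c = n(\Delta-1)/(2\Delta-1) = a(\Delta-1) + k_1 + k_2/(2\Delta-1)$, so the optimal $c$ is one of
  the two integers next to this value; the third bound is at most $(n-1)^2/4$. Vanishing of the slacks
  is the extremal structure.
\<close>

subsection \<open>Stars and rainbow stars\<close>

definition star :: "'a \<Rightarrow> 'a set \<Rightarrow> 'a ugraph" where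
  "star u N = \<lparr>uverts = insert u N, uedges = (\<lambda>w. {u, w}) ` N\<rparr>"

lemma star_sel [simp]:
  "uverts (star u N) = insert u N"
  "uedges (star u N) = (\<lambda>w. {u, w}) ` N"
  by (simp_all add: star_def)

lemma ugraph_isomorphic_K1_iff:
  "wf_ugraph G \<and> ugraph_isomorphic G (K1 d) \<longleftrightarrow>
     (\<exists>u N. G = star u N \<and> finite N \<and> u \<notin> N \<and> card N = d)"
proof
  assume asm: "wf_ugraph G \<and> ugraph_isomorphic G (K1 d)"
  then obtain f where f: "bij_betw f (uverts G) {0..d}"
    and fe: "{{0, i} | i. i \<in> {1..d}} = (\<lambda>e. f ` e) ` uedges G"
    by (auto simp: ugraph_isomorphic_def K1_def)
  from asm have fin: "finite (uverts G)"
    and wf: "\<And>e. e \<in> uedges G \<Longrightarrow> e \<subseteq> uverts G \<and> card e = 2"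
    by (auto simp: wf_ugraph_def)
  from f have inj: "inj_on f (uverts G)" and im: "f ` uverts G = {0..d}"
    by (auto simp: bij_betw_def)
  obtain u where u: "u \<in> uverts G" "f u = 0"
    using im by (metis atLeastAtMost_iff imageE le0)
  define N where "N = uverts G - {u}"
  have verts: "uverts G = insert u N"
    using u by (auto simp: N_def)
  have "uedges G = (\<lambda>w. {u, w}) ` N"
  proof (intro equalityI subsetI)
    fix e assume e: "e \<in> uedges G"
    then have "f ` e \<in> {{0, i} | i. i \<in> {1..d}}"
      using fe by blast
    then have "0 \<in> f ` e"
      by auto
    then obtain x where "x \<in> e" "f x = 0"
      by auto
    then have "u \<in> e"
      using inj u wf[OF e] by (metis inj_onD subsetD)
    moreover obtain x y where "e = {x, y}" "x \<noteq> y"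
      using wf[OF e] by (meson card_2_iff)
    ultimately obtain w where "e = {u, w}" "w \<noteq> u"
      by auto
    then show "e \<in> (\<lambda>w. {u, w}) ` N"
      using wf[OF e] by (auto simp: N_def)
  next
    fix e assume "e \<in> (\<lambda>w. {u, w}) ` N"
    then obtain w where w: "e = {u, w}" "w \<in> uverts G" "w \<noteq> u"
      by (auto simp: N_def)
    then have "f w \<in> {0..d}" "f w \<noteq> 0"
      using im u inj_on_eq_iff[OF inj w(2) u(1)] by auto
    then have "{0, f w} \<in> (\<lambda>e. f ` e) ` uedges G"
      unfolding fe[symmetric] by auto
    then obtain e' where e': "e' \<in> uedges G" "f ` e' = f ` e"
      using w u by auto
    then have "e' = e"
      using inj_on_image_eq_iff[OF inj, of e' e] wf[OF e'(1)] w u by simp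
    then show "e \<in> uedges G"
      using e' by simp
  qed
  then have "G = star u N"
    using verts by (cases G) (auto simp: star_def)
  moreover have "card N = d"
    using bij_betw_same_card[OF f] u fin by (simp add: N_def)
  ultimately show "\<exists>u N. G = star u N \<and> finite N \<and> u \<notin> N \<and> card N = d"
    using fin by (auto simp: N_def)
next
  assume "\<exists>u N. G = star u N \<and> finite N \<and> u \<notin> N \<and> card N = d"
  then obtain u N where G: "G = star u N" and N: "finite N" "u \<notin> N" "card N = d"
    by blast
  obtain h where h: "bij_betw h N {1..d}"
    using N by (metis finite_same_card_bij card_atLeastAtMost diff_Suc_1 finite_atLeastAtMost)
  define f where "f = h(u := 0)"
  have fN: "\<And>w. w \<in> N \<Longrightarrow> f w = h w" and fu: "f u = 0"
    using N by (auto simp: f_def)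
  have fh: "bij_betw f N {1..d}"
    using h fN by (simp cong: bij_betw_cong)
  have "bij_betw f (N \<union> {u}) ({1..d} \<union> {0})"
    by (rule bij_betw_combine[OF fh]) (auto simp: fu)
  moreover have "{1..d} \<union> {0} = {0..d}"
    by auto
  ultimately have "bij_betw f (uverts G) {0..d}"
    by (simp add: G)
  moreover have "{{0, i} | i. i \<in> {1..d}} = (\<lambda>e. f ` e) ` uedges G"
    using bij_betw_imp_surj_on[OF fh, symmetric] by (auto simp: G fu image_image)
  ultimately have "ugraph_isomorphic G (K1 d)"
    by (auto simp: ugraph_isomorphic_def K1_def)
  moreover have "wf_ugraph G"
    using N by (auto simp: G wf_ugraph_def card_2_iff)
  ultimately show "wf_ugraph G \<and> ugraph_isomorphic G (K1 d)"
    by blast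
qed

lemma star_on_iff:
  "star_on V d G \<longleftrightarrow>
     (\<exists>u N. G = star u N \<and> finite N \<and> u \<notin> N \<and> card N = d \<and> u \<in> V \<and> N \<subseteq> V)"
proof -
  have "star_on V d G \<longleftrightarrow>
      uverts G \<subseteq> V \<and> (\<exists>u N. G = star u N \<and> finite N \<and> u \<notin> N \<and> card N = d)"
    unfolding ugraph_isomorphic_K1_iff[symmetric] by (auto simp: star_on_def)
  also have "\<dots> \<longleftrightarrow>
      (\<exists>u N. G = star u N \<and> finite N \<and> u \<notin> N \<and> card N = d \<and> u \<in> V \<and> N \<subseteq> V)"
    by (metis insert_subset star_sel(1))
  finally show ?thesis .
qed

lemma is_center_star_iff:
  assumes "u \<notin> N" "card N = d" "2 \<le> d"
  shows "is_center d (star u N) v \<longleftrightarrow> v = u"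
proof -
  have inj: "inj_on (\<lambda>w. {u, w}) N"
    by (auto simp: inj_on_def doubleton_eq_iff)
  have "udegree (star u N) u = d"
  proof -
    have "{e \<in> uedges (star u N). u \<in> e} = (\<lambda>w. {u, w}) ` N"
      by auto
    then show ?thesis
      using card_image[OF inj] assms by (simp add: udegree_def)
  qed
  moreover have "udegree (star u N) v \<le> 1" if "v \<noteq> u"
  proof -
    have "{e \<in> uedges (star u N). v \<in> e} \<subseteq> {{u, v}}"
      using that by auto
    then show ?thesis
      unfolding udegree_def by (metis card_mono card.empty card.insert empty_iff finite.emptyI finite.insertI One_nat_def)
  qed
  ultimately show ?thesis
    using assms by (fastforce simp: is_center_def)
qed

lemma contains_rainbow_K1_iff:
  "contains_rainbow S (K1 d) \<longleftrightarrow>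
     (\<exists>Gs v N \<psi>. mset Gs = S \<and> finite N \<and> v \<notin> N \<and> card N = d \<and> inj_on \<psi> N \<and>
        (\<forall>w\<in>N. \<psi> w < length Gs \<and> {v, w} \<in> uedges (Gs ! \<psi> w)))"
proof
  assume "contains_rainbow S (K1 d)"
  then obtain Gs F \<phi> where *: "mset Gs = S" "wf_ugraph F \<and> ugraph_isomorphic F (K1 d)"
    "inj_on \<phi> (uedges F)" "\<forall>e \<in> uedges F. \<phi> e < length Gs \<and> e \<in> uedges (Gs ! \<phi> e)"
    unfolding contains_rainbow_def by blast
  then obtain v N where F: "F = star v N" "finite N" "v \<notin> N" "card N = d"
    by (auto simp: ugraph_isomorphic_K1_iff)
  have "inj_on (\<lambda>w. \<phi> {v, w}) N"
  proof (rule inj_onI)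
    fix w w' assume "w \<in> N" "w' \<in> N" "\<phi> {v, w} = \<phi> {v, w'}"
    then have "{v, w} = {v, w'}"
      using *(3) by (auto simp: F dest: inj_onD)
    then show "w = w'"
      by (auto simp: doubleton_eq_iff)
  qed
  then show "\<exists>Gs v N \<psi>. mset Gs = S \<and> finite N \<and> v \<notin> N \<and> card N = d \<and> inj_on \<psi> N \<and>
        (\<forall>w\<in>N. \<psi> w < length Gs \<and> {v, w} \<in> uedges (Gs ! \<psi> w))"
    using * F by (intro exI[of _ Gs] exI[of _ v] exI[of _ N] exI[of _ "\<lambda>w. \<phi> {v, w}"]) auto
next
  assume "\<exists>Gs v N \<psi>. mset Gs = S \<and> finite N \<and> v \<notin> N \<and> card N = d \<and> inj_on \<psi> N \<and>
        (\<forall>w\<in>N. \<psi> w < length Gs \<and> {v, w} \<in> uedges (Gs ! \<psi> w))"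
  then obtain Gs v N \<psi> where *: "mset Gs = S" "finite N" "v \<notin> N" "card N = d" "inj_on \<psi> N"
        "\<And>w. w\<in>N \<Longrightarrow> \<psi> w < length Gs \<and> {v, w} \<in> uedges (Gs ! \<psi> w)"
    by blast
  define \<phi> where "\<phi> e = \<psi> (the_elem (e - {v}))" for e
  have \<phi>: "\<phi> {v, w} = \<psi> w" if "w \<in> N" for w
  proof -
    have "{v, w} - {v} = {w}"
      using that * by auto
    then show ?thesis
      by (simp add: \<phi>_def)
  qed
  have "wf_ugraph (star v N) \<and> ugraph_isomorphic (star v N) (K1 d)"
    using * by (auto simp: ugraph_isomorphic_K1_iff)
  moreover have "inj_on \<phi> (uedges (star v N))"
    using *(5) by (auto simp: inj_on_def \<phi>)
  moreover have "\<forall>e \<in> uedges (star v N). \<phi> e < length Gs \<and> e \<in> uedges (Gs ! \<phi> e)"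
    using *(6) by (auto simp: \<phi>)
  ultimately show "contains_rainbow S (K1 d)"
    unfolding contains_rainbow_def using *(1) by blast
qed

lemma transversal_avoiding:
  assumes "finite I" "finite P" "\<And>i. i \<in> I \<Longrightarrow> finite (A i) \<and> card P + card I \<le> card (A i)"
  shows "\<exists>g. inj_on g I \<and> (\<forall>i\<in>I. g i \<in> A i - P)"
  using assms(1,3)
proof (induction I rule: finite_induct)
  case (insert x I)
  then obtain g where g: "inj_on g I" "\<forall>i\<in>I. g i \<in> A i - P"
    by fastforce
  have "card (P \<union> g ` I) \<le> card P + card I"
    using card_Un_le[of P "g ` I"] card_image[OF g(1)] by simp
  also have "\<dots> < card (A x)"
    using insert.prems[of x] insert.hyps by simp
  finally have "\<not> A x \<subseteq> P \<union> g ` I"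
    using assms(2) insert.hyps by (meson card_mono finite_UnI finite_imageI not_le)
  then obtain y where y: "y \<in> A x" "y \<notin> P" "y \<notin> g ` I"
    by blast
  have "inj_on (g(x := y)) (insert x I)"
    using g y insert.hyps by (auto simp: inj_on_def)
  moreover have "\<forall>i\<in>insert x I. (g(x := y)) i \<in> A i - P"
    using g y by auto
  ultimately show ?case
    by blast
qed simp

subsection \<open>Counting arcs\<close>

lemma sum_card_in_eq_sum_card_out:
  assumes "finite C" "finite X"
  shows "(\<Sum>v\<in>X. card {u \<in> C. v \<in> Out u}) = (\<Sum>u\<in>C. card (Out u \<inter> X))"
proof -
  have "(\<Sum>v\<in>X. card {u \<in> C. v \<in> Out u}) = (\<Sum>v\<in>X. \<Sum>u\<in>C. if v \<in> Out u then 1 else 0)"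
    using assms by (simp add: sum.If_cases Int_def)
  also have "\<dots> = (\<Sum>u\<in>C. \<Sum>v\<in>X. if v \<in> Out u then 1 else 0)"
    by (rule sum.swap)
  also have "\<dots> = (\<Sum>u\<in>C. card (Out u \<inter> X))"
    using assms by (simp add: sum.If_cases Int_def conj_commute)
  finally show ?thesis .
qed

text \<open>
  Here \<open>m u\<close> stands for the number of stars with center \<open>u\<close> and \<open>Out u\<close> for the union of their
  leaf sets; an element of \<open>Out u\<close> need not lie outside \<open>C\<close>.
\<close>

locale out_sets =
  fixes V C :: "'a set" and m :: "'a \<Rightarrow> nat" and Out :: "'a \<Rightarrow> 'a set" and \<Delta> :: nat
  assumes finite_V: "finite V" and C_subset: "C \<subseteq> V"
    and Out_subset: "u \<in> C \<Longrightarrow> Out u \<subseteq> V"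
    and card_Out: "u \<in> C \<Longrightarrow> \<Delta> \<le> card (Out u)"
    and degree_le: "v \<in> V \<Longrightarrow> m v + card {u \<in> C. v \<in> Out u} \<le> \<Delta> - 1"
    and Delta_ge: "2 \<le> \<Delta>"
begin

abbreviation indeg :: "'a \<Rightarrow> nat" where
  "indeg v \<equiv> card {u \<in> C. v \<in> Out u}"

abbreviation c :: int where "c \<equiv> int (card C)"
abbreviation l :: int where "l \<equiv> int (card (V - C))"
abbreviation d :: int where "d \<equiv> int \<Delta>"
abbreviation total :: int where "total \<equiv> int (\<Sum>u\<in>C. m u)"

lemma finite_C: "finite C"
  using C_subset finite_V finite_subset by blast

lemma finite_Out: "u \<in> C \<Longrightarrow> finite (Out u)"
  using Out_subset finite_V finite_subset by blast

lemma degree_le_int: "v \<in> V \<Longrightarrow> int (m v) + int (indeg v) \<le> d - 1"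
  using degree_le[of v] Delta_ge by linarith

lemma c_plus_l: "c + l = int (card V)"
  using C_subset finite_V finite_C
  by (metis card_Diff_subset card_mono le_add_diff_inverse of_nat_add)

lemma card_Out_split: "u \<in> C \<Longrightarrow> card (Out u) = card (Out u \<inter> C) + card (Out u \<inter> (V - C))"
  using Out_subset[of u] finite_Out[of u]
  by (subst card_Un_disjoint[symmetric]) (auto intro: arg_cong[where f = card])

lemma total_eq_inner:
  "total = c * (d - 1) - (\<Sum>u\<in>C. int (card (Out u \<inter> C)))
             - (\<Sum>u\<in>C. d - 1 - int (m u) - int (indeg u))"
proof -
  have "(\<Sum>u\<in>C. int (indeg u)) = (\<Sum>u\<in>C. int (card (Out u \<inter> C)))"
    using sum_card_in_eq_sum_card_out[OF finite_C finite_C, of Out] by (simp flip: of_nat_sum)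
  then show ?thesis
    by (simp add: sum_subtractf)
qed

lemma total_eq_all:
  "total = int (card V) * (d - 1) - c * d
             - (\<Sum>u\<in>C. d - 1 - int (m u) - int (indeg u))
             - (\<Sum>v\<in>V - C. d - 1 - int (indeg v))
             - (\<Sum>u\<in>C. int (card (Out u)) - d)"
proof -
  have "(\<Sum>v\<in>V - C. int (indeg v)) = (\<Sum>u\<in>C. int (card (Out u \<inter> (V - C))))"
    using sum_card_in_eq_sum_card_out[OF finite_C, of "V - C" Out] finite_V
    by (simp flip: of_nat_sum)
  moreover have "(\<Sum>u\<in>C. int (card (Out u)))
      = (\<Sum>u\<in>C. int (card (Out u \<inter> C))) + (\<Sum>u\<in>C. int (card (Out u \<inter> (V - C))))"
    by (simp add: card_Out_split sum.distrib)
  ultimately show ?thesis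
    unfolding total_eq_inner c_plus_l[symmetric]
    by (simp add: sum_subtractf sum.distrib algebra_simps)
qed

lemma total_eq_complete:
  "total = c * (l - 1) - (\<Sum>u\<in>C. d - 1 - int (m u) - int (indeg u))
             - (\<Sum>u\<in>C. int (card (Out u \<inter> C)) - (d - l))"
  unfolding total_eq_inner by (simp add: sum_subtractf sum.distrib algebra_simps)

lemma slack_nonneg: "v \<in> V \<Longrightarrow> 0 \<le> d - 1 - int (m v) - int (indeg v)"
  using degree_le_int[of v] by simp

lemma indeg_slack_nonneg: "v \<in> V \<Longrightarrow> 0 \<le> d - 1 - int (indeg v)"
  using degree_le_int[of v] by simp

lemma out_slack_nonneg: "u \<in> C \<Longrightarrow> 0 \<le> int (card (Out u)) - d"
  using card_Out by simp

lemma inner_slack_nonneg: "u \<in> C \<Longrightarrow> 0 \<le> int (card (Out u \<inter> C)) - (d - l)"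
  using card_Out_split[of u] card_Out[of u] card_mono[of "V - C" "Out u \<inter> (V - C)"] finite_V
  by auto

lemma sum_slack_nonneg:
  "0 \<le> (\<Sum>u\<in>C. d - 1 - int (m u) - int (indeg u))"
  "0 \<le> (\<Sum>v\<in>V - C. d - 1 - int (indeg v))"
  "0 \<le> (\<Sum>u\<in>C. int (card (Out u)) - d)"
  "0 \<le> (\<Sum>u\<in>C. int (card (Out u \<inter> C)) - (d - l))"
  "0 \<le> (\<Sum>u\<in>C. int (card (Out u \<inter> C)))"
proof -
  show "0 \<le> (\<Sum>u\<in>C. d - 1 - int (m u) - int (indeg u))"
    by (rule sum_nonneg, rule slack_nonneg) (use C_subset in auto)
  show "0 \<le> (\<Sum>v\<in>V - C. d - 1 - int (indeg v))"
    by (rule sum_nonneg, rule indeg_slack_nonneg) auto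
  show "0 \<le> (\<Sum>u\<in>C. int (card (Out u)) - d)"
    by (rule sum_nonneg, rule out_slack_nonneg)
  show "0 \<le> (\<Sum>u\<in>C. int (card (Out u \<inter> C)) - (d - l))"
    by (rule sum_nonneg, rule inner_slack_nonneg)
qed (simp add: sum_nonneg)

lemma slack_eq_0:
  assumes "(\<Sum>u\<in>C. d - 1 - int (m u) - int (indeg u)) = 0" "u \<in> C"
  shows "int (m u) = d - 1 - int (indeg u)"
proof -
  have "\<forall>u\<in>C. d - 1 - int (m u) - int (indeg u) = 0"
    using assms sum_nonneg_eq_0_iff[OF finite_C, of "\<lambda>u. d - 1 - int (m u) - int (indeg u)"]
      slack_nonneg C_subset by blast
  then show ?thesis
    using assms(2) by fastforce
qed

lemma total_le:
  "total \<le> c * (d - 1)" "total \<le> int (card V) * (d - 1) - c * d" "total \<le> c * (l - 1)"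
  using total_eq_inner total_eq_all total_eq_complete sum_slack_nonneg by linarith+

lemma inner_bound_tight:
  assumes "total = c * (d - 1)" "u \<in> C"
  shows "m u = \<Delta> - 1" "Out u \<inter> C = {}"
proof -
  have s: "(\<Sum>u\<in>C. d - 1 - int (m u) - int (indeg u)) = 0" and i: "(\<Sum>u\<in>C. int (card (Out u \<inter> C))) = 0"
    using assms total_eq_inner sum_slack_nonneg by linarith+
  have disj: "Out u \<inter> C = {}" if "u \<in> C" for u
    using i that finite_C by (subst (asm) sum_nonneg_eq_0_iff) auto
  then show "Out u \<inter> C = {}"
    using assms by blast
  have "{w \<in> C. u \<in> Out w} = {}"
    using disj assms(2) by blast
  then have "indeg u = 0"
    by (simp only: card.empty)
  then show "m u = \<Delta> - 1"
    using slack_eq_0[OF s assms(2)] Delta_ge by linarith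
qed

lemma degree_bound_tight:
  assumes "total = int (card V) * (d - 1) - c * d"
  shows "u \<in> C \<Longrightarrow> int (m u) = d - 1 - int (indeg u)"
    and "v \<in> V - C \<Longrightarrow> indeg v = \<Delta> - 1"
    and "(\<Sum>u\<in>C. int (card (Out u \<inter> C))) = c * (2 * d - 1) - int (card V) * (d - 1)"
proof -
  have s: "(\<Sum>u\<in>C. d - 1 - int (m u) - int (indeg u)) = 0"
    and i: "(\<Sum>v\<in>V - C. d - 1 - int (indeg v)) = 0"
    using assms total_eq_all sum_slack_nonneg by linarith+
  then show "u \<in> C \<Longrightarrow> int (m u) = d - 1 - int (indeg u)"
    using slack_eq_0 by blast
  have "\<forall>v\<in>V - C. d - 1 - int (indeg v) = 0"
    using i indeg_slack_nonneg finite_V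
      sum_nonneg_eq_0_iff[of "V - C" "\<lambda>v. d - 1 - int (indeg v)"] by blast
  then have "d - 1 - int (indeg v) = 0" if "v \<in> V - C" for v
    using that by blast
  then show "v \<in> V - C \<Longrightarrow> indeg v = \<Delta> - 1"
    using Delta_ge by fastforce
  show "(\<Sum>u\<in>C. int (card (Out u \<inter> C))) = c * (2 * d - 1) - int (card V) * (d - 1)"
    using total_eq_inner assms s by (simp add: algebra_simps)
qed

lemma complete_bound_tight:
  assumes "total = c * (l - 1)" "u \<in> C"
  shows "int (m u) = d - 1 - int (indeg u)" "int (card (Out u \<inter> C)) = d - l"
proof -
  have s: "(\<Sum>u\<in>C. d - 1 - int (m u) - int (indeg u)) = 0"
    and i: "(\<Sum>u\<in>C. int (card (Out u \<inter> C)) - (d - l)) = 0"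
    using assms total_eq_complete sum_slack_nonneg by linarith+
  then show "int (m u) = d - 1 - int (indeg u)"
    using slack_eq_0 assms by blast
  have "\<forall>u\<in>C. int (card (Out u \<inter> C)) - (d - l) = 0"
    using i inner_slack_nonneg
      sum_nonneg_eq_0_iff[OF finite_C, of "\<lambda>u. int (card (Out u \<inter> C)) - (d - l)"] by blast
  then show "int (card (Out u \<inter> C)) = d - l"
    using assms(2) by fastforce
qed

end

subsection \<open>Balanced out-neighborhoods\<close>

lemma mod_window_inj:
  fixes p q l k :: nat
  assumes "p mod l = q mod l" "k \<le> p" "p < k + l" "k \<le> q" "q < k + l"
  shows "p = q"
proof (rule ccontr)
  assume "p \<noteq> q"
  have "l dvd p - q" "l dvd q - p"
    using assms(1) by (metis mod_eq_dvd_iff_nat nat_le_linear diff_is_0_eq dvd_0_right)+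
  then show False
    using assms \<open>p \<noteq> q\<close> by (auto dest!: dvd_imp_le split: nat_diff_split_asm)
qed

text \<open>
  The \<open>c * (D + 1)\<close> arcs are laid out in one row, center \<open>i\<close> owning the window \<open>W i\<close> of length
  \<open>D + 1\<close>. The first \<open>l * D\<close> positions run cyclically through \<open>V - C\<close>, hitting each vertex \<open>D\<close>
  times; the at most \<open>e\<close> remaining ones all belong to the last center and go to distinct other
  centers.
\<close>

lemma balanced_out_sets_exist:
  fixes V C :: "'a set" and D e :: nat
  assumes "finite V" "C \<subseteq> V" "1 \<le> D" "D + 1 \<le> card (V - C)"
    and le: "card C * (D + 1) \<le> card (V - C) * D + e" and "e \<le> D" "e < card C"
  shows "\<exists>N. (\<forall>u\<in>C. N u \<subseteq> V - {u} \<and> card (N u) = D + 1) \<and>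
             (\<forall>v\<in>V. card {u \<in> C. v \<in> N u} \<le> D) \<and>
             (\<Sum>v\<in>C. card {u \<in> C. v \<in> N u}) \<le> e"
proof -
  define c where "c = card C"
  define l where "l = card (V - C)"
  have "finite C" "finite (V - C)"
    using assms finite_subset by auto
  obtain x where x: "bij_betw x {..<c} C"
    using \<open>finite C\<close> unfolding c_def by (metis bij_betw_from_nat_into_finite)
  obtain y where y: "bij_betw y {..<l} (V - C)"
    using \<open>finite (V - C)\<close> unfolding l_def by (metis bij_betw_from_nat_into_finite)
  have x_in: "x i \<in> C" if "i < c" for i
    using x that by (auto simp: bij_betw_def)
  have x_surj: "\<exists>i<c. u = x i" if "u \<in> C" for u
    using x that by (metis bij_betw_imp_surj_on imageE lessThan_iff)
  have x_inj: "i = j" if "x i = x j" "i < c" "j < c" for i j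
    using x that by (auto simp: bij_betw_def inj_on_def)
  have y_in: "y i \<in> V - C" if "i < l" for i
    using y that by (auto simp: bij_betw_def)
  have y_inj: "i = j" if "y i = y j" "i < l" "j < l" for i j
    using y that by (auto simp: bij_betw_def inj_on_def)
  define h where "h p = (if p < l * D then y (p mod l) else x (p - l * D))" for p
  define W where "W i = {i * (D + 1)..<i * (D + 1) + (D + 1)}" for i
  define N where "N u = h ` W (inv_into {..<c} x u)" for u
  have N_x: "N (x i) = h ` W i" if "i < c" for i
    using x that by (simp add: N_def bij_betw_def inv_into_f_f)
  have l: "D + 1 \<le> l" "0 < l" and lD: "c * (D + 1) \<le> l * D + e" and e: "e \<le> D" "e < c"
    using assms by (auto simp: l_def c_def)
  have W_less: "p < c * (D + 1)" if "p \<in> W i" "i < c" for p i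
  proof -
    have "(i + 1) * (D + 1) \<le> c * (D + 1)"
      using that by (intro mult_right_mono) auto
    then show ?thesis
      using that by (auto simp: W_def)
  qed
  have W_div: "p div (D + 1) = i" if "p \<in> W i" for p i
    using that by (intro div_nat_eqI) (auto simp: W_def algebra_simps)
  have h_L: "h p \<in> V - C" if "p < l * D" for p
    using that y_in l by (simp add: h_def)
  have h_C: "h p \<in> C" "p - l * D < e" if "\<not> p < l * D" "p \<in> W i" "i < c" for p i
    using that W_less[OF that(2,3)] lD e x_in[of "p - l * D"] by (auto simp: h_def)
  have h_ne: "h p \<noteq> x i" if "p \<in> W i" "i < c" for p i
  proof
    assume eq: "h p = x i"
    then have p: "\<not> p < l * D"
      using h_L x_in[OF that(2)] by force
    then have "p - l * D = i"
      using eq h_C(2)[OF p that] e x_inj[of "p - l * D" i] that by (simp add: h_def)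
    then have "i + 2 \<le> c"
      using h_C(2)[OF p that] e by linarith
    then have "(i + 2) * (D + 1) \<le> c * (D + 1)"
      by (intro mult_right_mono) auto
    then show False
      using p lD e that(1) by (auto simp: W_def)
  qed
  have h_V: "h p \<in> V" if "p \<in> W i" "i < c" for p i
    using h_L[of p] h_C(1)[OF _ that] assms(2) by blast
  have h_inj: "inj_on h (W i)" if "i < c" for i
  proof (rule inj_onI)
    fix p q assume pq: "p \<in> W i" "q \<in> W i" "h p = h q"
    have "p < l * D \<longleftrightarrow> q < l * D"
      using h_L[of p] h_L[of q] h_C(1)[OF _ pq(1) that] h_C(1)[OF _ pq(2) that] pq(3) by auto
    then consider "p < l * D" "q < l * D" | "\<not> p < l * D" "\<not> q < l * D"
      by blast
    then show "p = q"
    proof cases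
      case 1
      then have "p mod l = q mod l"
        using pq(3) y_inj l by (simp add: h_def)
      then show ?thesis
        by (rule mod_window_inj[of _ _ _ "i * (D + 1)"]) (use pq l in \<open>auto simp: W_def\<close>)
    next
      case 2
      then have "p - l * D = q - l * D"
        using pq(3) h_C(2)[OF _ pq(1) that] h_C(2)[OF _ pq(2) that] e x_inj
        by (simp add: h_def)
      then show ?thesis
        using 2 by linarith
    qed
  qed
  have N_C: "N u \<subseteq> V - {u} \<and> card (N u) = D + 1" if "u \<in> C" for u
  proof -
    obtain i where i: "i < c" "u = x i"
      using \<open>u \<in> C\<close> x_surj by blast
    then show ?thesis
      using h_V h_ne card_image[OF h_inj[OF i(1)]] by (auto simp: N_x W_def)
  qed
  have in_N: "\<exists>p. h p = v \<and> u = x (p div (D + 1)) \<and> p < c * (D + 1) \<and> (p < l * D \<or> p - l * D < e)"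
    if "u \<in> C" "v \<in> N u" for u v
  proof -
    obtain i where i: "i < c" "u = x i"
      using \<open>u \<in> C\<close> x_surj by blast
    then obtain p where p: "p \<in> W i" "h p = v"
      using \<open>v \<in> N u\<close> by (auto simp: N_x)
    then show ?thesis
      using W_div[OF p(1)] W_less[OF p(1) i(1)] h_C(2)[OF _ p(1) i(1)] i by blast
  qed
  have C_deg: "card {u \<in> C. x q \<in> N u} \<le> (if q < e then 1 else 0)" if "q < c" for q
  proof -
    have *: "u = x ((l * D + q) div (D + 1)) \<and> q < e" if u: "u \<in> C" "x q \<in> N u" for u
    proof -
      obtain p where p: "h p = x q" "u = x (p div (D + 1))" "p < l * D \<or> p - l * D < e"
        using in_N[OF u] by blast
      then have "\<not> p < l * D"
        using h_L[of p] x_in[OF \<open>q < c\<close>] by auto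
      moreover from this have "p - l * D = q"
        using p x_inj[of "p - l * D" q] \<open>q < c\<close> e by (simp add: h_def)
      ultimately show ?thesis
        using p by auto
    qed
    then have "{u \<in> C. x q \<in> N u} \<subseteq> (if q < e then {x ((l * D + q) div (D + 1))} else {})"
      by auto
    then have "card {u \<in> C. x q \<in> N u} \<le> card (if q < e then {x ((l * D + q) div (D + 1))} else {})"
      by (rule card_mono[rotated]) simp
    then show ?thesis
      by (cases "q < e") simp_all
  qed
  have V_deg: "card {u \<in> C. v \<in> N u} \<le> D" if "v \<in> V" for v
  proof (cases "v \<in> C")
    case True
    then obtain q where "q < c" "v = x q"
      using x_surj by blast
    then show ?thesis
      using C_deg[of q] assms(3) by (simp split: if_splits)
  next
    case False
    then obtain q where q: "q < l" "v = y q"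
      using \<open>v \<in> V\<close> y by (metis DiffI bij_betw_imp_surj_on imageE lessThan_iff)
    have "{u \<in> C. v \<in> N u} \<subseteq> (\<lambda>j. x ((j * l + q) div (D + 1))) ` {..<D}"
    proof
      fix u assume "u \<in> {u \<in> C. v \<in> N u}"
      then obtain p where p: "h p = v" "u = x (p div (D + 1))" "p < l * D \<or> p - l * D < e"
        using in_N[of u v] by blast
      have "p < l * D"
        using p False x_in[of "p - l * D"] e by (auto simp: h_def split: if_splits)
      then have "p mod l = q"
        using p q y_inj[of "p mod l" q] l by (simp add: h_def)
      then have "p = (p div l) * l + q"
        using div_mult_mod_eq[of p l] by simp
      moreover have "p div l < D"
        using \<open>p < l * D\<close> by (simp add: less_mult_imp_div_less mult.commute)
      ultimately show "u \<in> (\<lambda>j. x ((j * l + q) div (D + 1))) ` {..<D}"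
        using p(2) by (intro image_eqI[of _ _ "p div l"]) simp_all
    qed
    then have "card {u \<in> C. v \<in> N u} \<le> card {..<D}"
      by (meson surj_card_le finite_lessThan)
    then show ?thesis
      by simp
  qed
  have "(\<Sum>v\<in>C. card {u \<in> C. v \<in> N u}) = (\<Sum>q<c. card {u \<in> C. x q \<in> N u})"
    using sum.reindex_bij_betw[OF x, of "\<lambda>v. card {u \<in> C. v \<in> N u}"] by simp
  also have "\<dots> \<le> (\<Sum>q<c. if q < e then 1 else 0)"
    by (intro sum_mono C_deg) simp
  also have "\<dots> = e"
  proof -
    have "{..<c} \<inter> {q. q < e} = {..<e}"
      using e by auto
    then show ?thesis
      by (simp add: sum.If_cases)
  qed
  finally show ?thesis
    using N_C V_deg by blast
qed

subsection \<open>Rainbow-free collections of stars\<close>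

definition out_leaves :: "nat \<Rightarrow> 'a ugraph multiset \<Rightarrow> 'a \<Rightarrow> 'a set" where
  "out_leaves \<Delta> S u = {v. \<exists>G \<in># stars_at \<Delta> S u. {u, v} \<in> uedges G}"

text \<open>For \<open>\<Delta> = 1\<close> both ends of a star are centers, so this case is excluded and treated separately.\<close>

locale star_collection =
  fixes V :: "'a set" and \<Delta> :: nat and S :: "'a ugraph multiset"
  assumes finite_V: "finite V" and Delta_ge: "2 \<le> \<Delta>" and S: "S \<in> star_collections V \<Delta>"
begin

abbreviation "C \<equiv> centers V \<Delta> S"
abbreviation "Out \<equiv> out_leaves \<Delta> S"
abbreviation "m u \<equiv> size (stars_at \<Delta> S u)"
abbreviation "indeg v \<equiv> card {u \<in> C. v \<in> Out u}"

lemma C_subset: "C \<subseteq> V"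
  by (auto simp: centers_def)

lemma finite_C: "finite C"
  using C_subset finite_V finite_subset by blast

lemma memberE:
  assumes "G \<in># S"
  obtains u N where "G = star u N" "finite N" "u \<notin> N" "card N = \<Delta>" "u \<in> V" "N \<subseteq> V"
    "is_center \<Delta> G = (\<lambda>v. v = u)"
proof -
  have "star_on V \<Delta> G"
    using S assms by (auto simp: star_collections_def)
  then obtain u N where "G = star u N" "finite N" "u \<notin> N" "card N = \<Delta>" "u \<in> V" "N \<subseteq> V"
    by (auto simp: star_on_iff)
  then show ?thesis
    using that is_center_star_iff[of u N \<Delta>] Delta_ge by blast
qed

lemma stars_atE:
  assumes "G \<in># stars_at \<Delta> S u"
  obtains N where "G = star u N" "finite N" "u \<notin> N" "card N = \<Delta>" "N \<subseteq> V"
proof -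
  have "G \<in># S" "is_center \<Delta> G u"
    using assms by (auto simp: stars_at_def)
  from \<open>G \<in># S\<close> show ?thesis
    by (rule memberE) (use \<open>is_center \<Delta> G u\<close> that in auto)
qed

lemma stars_at_nonempty: "u \<in> C \<Longrightarrow> \<exists>G. G \<in># stars_at \<Delta> S u"
  by (auto simp: centers_def)

lemma stars_at_imp_center:
  assumes "G \<in># stars_at \<Delta> S u"
  shows "u \<in> C"
proof -
  have "G \<in># S" "is_center \<Delta> G u"
    using assms by (auto simp: stars_at_def)
  then have "u \<in> V"
    by (auto elim: memberE)
  then show ?thesis
    using assms by (auto simp: centers_def)
qed

lemma Out_imp_center: "v \<in> Out u \<Longrightarrow> u \<in> C"
  by (auto simp: out_leaves_def intro: stars_at_imp_center)

lemma leaves_subset_Out: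
  assumes "G \<in># stars_at \<Delta> S u"
  shows "star_leaves G u \<subseteq> Out u"
proof
  fix v assume "v \<in> star_leaves G u"
  then have "{u, v} \<in> uedges G"
    using assms by (auto simp: star_leaves_def elim!: stars_atE)
  then show "v \<in> Out u"
    using assms by (auto simp: out_leaves_def)
qed

lemma mem_OutE:
  assumes "v \<in> Out u"
  obtains G where "G \<in># stars_at \<Delta> S u" "v \<in> star_leaves G u" "{u, v} \<in> uedges G"
proof -
  obtain G where G: "G \<in># stars_at \<Delta> S u" "{u, v} \<in> uedges G"
    using assms by (auto simp: out_leaves_def)
  then have "v \<in> star_leaves G u"
    by (auto simp: star_leaves_def doubleton_eq_iff elim!: stars_atE)
  then show ?thesis
    using that G by blast
qed

lemma star_leaves_at:
  assumes "G \<in># stars_at \<Delta> S u"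
  shows "finite (star_leaves G u)" "card (star_leaves G u) = \<Delta>" "star_leaves G u \<subseteq> V - {u}"
    "w \<in> star_leaves G u \<longleftrightarrow> {u, w} \<in> uedges G"
  using assms by (auto simp: star_leaves_def doubleton_eq_iff elim!: stars_atE)

lemma Out_subset: "Out u \<subseteq> V - {u}"
  using star_leaves_at(3) by (blast elim: mem_OutE)

lemma card_Out:
  assumes "u \<in> C" shows "\<Delta> \<le> card (Out u)"
proof -
  obtain G where G: "G \<in># stars_at \<Delta> S u"
    using assms stars_at_nonempty by blast
  have "finite (Out u)"
    using Out_subset[of u] finite_V finite_subset by blast
  then show ?thesis
    using card_mono[OF _ leaves_subset_Out[OF G]] star_leaves_at(2)[OF G] by simp
qed

lemma size_eq: "size S = (\<Sum>u\<in>C. m u)"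
proof -
  have "(\<Sum>u\<in>V. size (filter_mset (\<lambda>G. is_center \<Delta> G u) T)) = size T" if "T \<subseteq># S" for T
    using that
  proof (induction T)
    case (add G T)
    then have "G \<in># S" "T \<subseteq># S"
      using mset_subset_eq_insertD by (metis subset_mset.less_imp_le)+
    from \<open>G \<in># S\<close> obtain c N where c: "G = star c N" "finite N" "c \<notin> N" "card N = \<Delta>"
      "c \<in> V" "N \<subseteq> V" "is_center \<Delta> G = (\<lambda>v. v = c)"
      by (rule memberE)
    have "(\<Sum>u\<in>V. size (filter_mset (\<lambda>G. is_center \<Delta> G u) (add_mset G T)))
        = (\<Sum>u\<in>V. (if u = c then 1 else 0) + size (filter_mset (\<lambda>G. is_center \<Delta> G u) T))"
      by (rule sum.cong) (auto simp: c(7))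
    also have "\<dots> = size (add_mset G T)"
      using add.IH[OF \<open>T \<subseteq># S\<close>] c(5) finite_V by (simp add: sum.distrib)
    finally show ?case .
  qed simp
  from this[of S] have "size S = (\<Sum>u\<in>V. m u)"
    by (simp add: stars_at_def)
  also have "\<dots> = (\<Sum>u\<in>C. m u)"
    by (rule sum.mono_neutral_right) (use finite_V in \<open>auto simp: centers_def\<close>)
  finally show ?thesis .
qed

lemma arcs_star_digraph: "arcs (star_digraph V \<Delta> S) = Sigma C Out"
  by (auto simp: star_digraph_def out_leaves_def intro: stars_at_imp_center)

lemma in_degree_star_digraph: "in_degree (star_digraph V \<Delta> S) v = indeg v"
proof -
  have "in_arcs (star_digraph V \<Delta> S) v = (\<lambda>u. (u, v)) ` {u \<in> C. v \<in> Out u}"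
    by (auto simp: in_arcs_def arcs_star_digraph) (auto simp: star_digraph_def)
  then show ?thesis
    by (simp add: in_degree_def card_image inj_on_def)
qed

lemma arcs_induced: "arcs (star_digraph V \<Delta> S \<restriction> C) = Sigma C (\<lambda>u. Out u \<inter> C)"
  by (auto simp: arcs_star_digraph) (auto simp: star_digraph_def)

lemma card_arcs_induced: "card (arcs (star_digraph V \<Delta> S \<restriction> C)) = (\<Sum>u\<in>C. card (Out u \<inter> C))"
  unfolding arcs_induced using finite_C by (subst card_SigmaI) auto

lemma out_degree_induced:
  assumes "u \<in> C"
  shows "out_degree (star_digraph V \<Delta> S \<restriction> C) u = card (Out u \<inter> C)"
proof -
  have "out_arcs (star_digraph V \<Delta> S \<restriction> C) u = Pair u ` (Out u \<inter> C)"
    unfolding out_arcs_def arcs_induced using assms by (auto simp: star_digraph_def)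
  then show ?thesis
    by (simp add: out_degree_def card_image inj_on_def)
qed

lemma not_center: "u \<notin> C \<Longrightarrow> m u = 0"
  using stars_at_imp_center by (metis multiset_nonemptyE size_eq_0_iff_empty)

lemma rainbow_imp_degree:
  assumes "contains_rainbow S (K1 \<Delta>)"
  shows "\<exists>v\<in>V. \<Delta> \<le> m v + indeg v"
proof -
  obtain Gs v N \<psi> where *: "mset Gs = S" "finite N" "v \<notin> N" "card N = \<Delta>" "inj_on \<psi> N"
        "\<And>w. w\<in>N \<Longrightarrow> \<psi> w < length Gs \<and> {v, w} \<in> uedges (Gs ! \<psi> w)"
    using assms unfolding contains_rainbow_K1_iff by blast
  have mem: "Gs ! \<psi> w \<in># S" if "w \<in> N" for w
    using *(1) *(6)[OF that] by auto
  define N1 where "N1 = {w \<in> N. is_center \<Delta> (Gs ! \<psi> w) v}"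
  have "m v = card {i. i < length Gs \<and> is_center \<Delta> (Gs ! i) v}"
    unfolding stars_at_def *(1)[symmetric]
    by (simp flip: mset_filter add: length_filter_conv_card)
  moreover have "card N1 \<le> card {i. i < length Gs \<and> is_center \<Delta> (Gs ! i) v}"
    by (rule card_inj_on_le[of \<psi>]) (use * in \<open>auto simp: N1_def inj_on_def\<close>)
  moreover have "card (N - N1) \<le> indeg v"
  proof (rule card_mono)
    show "N - N1 \<subseteq> {u \<in> C. v \<in> Out u}"
    proof
      fix w assume w: "w \<in> N - N1"
      then have wN: "w \<in> N"
        by simp
      obtain u M where u: "Gs ! \<psi> w = star u M" "finite M" "u \<notin> M" "card M = \<Delta>"
        "u \<in> V" "M \<subseteq> V" "is_center \<Delta> (Gs ! \<psi> w) = (\<lambda>v. v = u)"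
        using mem[OF wN] by (rule memberE)
      have "{v, w} \<in> uedges (star u M)"
        using *(6)[OF wN] u by simp
      moreover have "u \<noteq> v"
        using w u(7) by (auto simp: N1_def)
      ultimately have "w = u" "v \<in> M"
        by (auto simp: doubleton_eq_iff)
      then have "v \<in> Out w"
        using u mem[OF wN] by (force simp: out_leaves_def stars_at_def)
      then show "w \<in> {u \<in> C. v \<in> Out u}"
        using Out_imp_center by blast
    qed
  qed (use finite_C in auto)
  moreover have "card N = card N1 + card (N - N1)"
  proof -
    have "N1 \<subseteq> N"
      by (auto simp: N1_def)
    then show ?thesis
      using *(2) by (metis card_Diff_subset card_mono finite_subset le_add_diff_inverse)
  qed
  ultimately have "\<Delta> \<le> m v + indeg v"
    using *(4) by linarith
  moreover have "v \<in> V"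
  proof -
    obtain w where w: "w \<in> N"
      using *(4) Delta_ge by fastforce
    obtain u M where "Gs ! \<psi> w = star u M" "finite M" "u \<notin> M" "card M = \<Delta>"
        "u \<in> V" "M \<subseteq> V" "is_center \<Delta> (Gs ! \<psi> w) = (\<lambda>v. v = u)"
      using mem[OF w] by (rule memberE)
    then show ?thesis
      using *(6)[OF w] by (auto simp: doubleton_eq_iff)
  qed
  ultimately show ?thesis
    by blast
qed

lemma degree_imp_rainbow:
  assumes "\<Delta> \<le> m v + indeg v"
  shows "contains_rainbow S (K1 \<Delta>)"
proof -
  obtain Gs where Gs: "mset Gs = S"
    using ex_mset by blast
  define J where "J = {i. i < length Gs \<and> is_center \<Delta> (Gs ! i) v}"
  have "finite J"
    by (simp add: J_def)
  have mJ: "m v = card J"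
    unfolding stars_at_def Gs[symmetric] J_def
    by (simp flip: mset_filter add: length_filter_conv_card)
  have "\<exists>P \<subseteq> {u \<in> C. v \<in> Out u}. card P = min \<Delta> (indeg v)"
    by (rule obtain_subset_with_card_n[of "min \<Delta> (indeg v)"]) auto
  then obtain P where P: "P \<subseteq> {u \<in> C. v \<in> Out u}" "card P = min \<Delta> (indeg v)"
    by blast
  have "finite P"
    using P(1) finite_C finite_subset by fastforce
  have "\<exists>I \<subseteq> J. card I = \<Delta> - card P"
    by (rule obtain_subset_with_card_n[of "\<Delta> - card P" J]) (use assms mJ P in auto)
  then obtain I where I: "I \<subseteq> J" "card I = \<Delta> - card P"
    by blast
  have "finite I"
    using I \<open>finite J\<close> finite_subset by blast
  have "\<exists>i<length Gs. is_center \<Delta> (Gs ! i) u \<and> {v, u} \<in> uedges (Gs ! i)" if "u \<in> P" for u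
  proof -
    have "v \<in> Out u"
      using that P by blast
    then obtain G where G: "G \<in># stars_at \<Delta> S u" "{u, v} \<in> uedges G"
      by (rule mem_OutE)
    then have "G \<in> set Gs" "is_center \<Delta> G u"
      using Gs by (auto simp: stars_at_def)
    then show ?thesis
      using G(2) by (metis in_set_conv_nth insert_commute)
  qed
  then obtain idx where idx: "\<And>u. u \<in> P \<Longrightarrow> idx u < length Gs \<and> is_center \<Delta> (Gs ! idx u) u
      \<and> {v, u} \<in> uedges (Gs ! idx u)"
    by metis
  have unique: "u = u'" if "i < length Gs" "is_center \<Delta> (Gs ! i) u" "is_center \<Delta> (Gs ! i) u'" for i u u'
  proof -
    have "Gs ! i \<in># S"
      using that(1) Gs by auto
    then show ?thesis
      using that(2,3) by (auto elim: memberE)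
  qed
  define A where "A i = star_leaves (Gs ! i) v" for i
  have J_at: "Gs ! i \<in># stars_at \<Delta> S v" if "i \<in> J" for i
    using that Gs by (auto simp: J_def stars_at_def)
  have "finite (A i) \<and> card P + card I \<le> card (A i)" if "i \<in> I" for i
    using star_leaves_at(1,2)[OF J_at] that I P unfolding A_def by auto
  then obtain g where g: "inj_on g I" "\<And>i. i \<in> I \<Longrightarrow> g i \<in> A i - P"
    using transversal_avoiding[OF \<open>finite I\<close> \<open>finite P\<close>, of A] by blast
  define \<psi> where "\<psi> w = (if w \<in> P then idx w else inv_into I g w)" for w
  have \<psi>g: "\<psi> (g i) = i" if "i \<in> I" for i
    using g that by (simp add: \<psi>_def inv_into_f_f)
  have "v \<notin> P"
    using P Out_subset by blast
  have idx_notin: "idx u \<notin> I" if "u \<in> P" for u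
    using unique[of "idx u" u v] idx[OF that] I \<open>v \<notin> P\<close> that by (auto simp: J_def)
  have "inj_on \<psi> (P \<union> g ` I)"
  proof (rule inj_onI)
    fix w w' assume w: "w \<in> P \<union> g ` I" "w' \<in> P \<union> g ` I" "\<psi> w = \<psi> w'"
    have 1: "\<psi> w \<in> I \<longleftrightarrow> w \<notin> P" "\<psi> w' \<in> I \<longleftrightarrow> w' \<notin> P"
      using w g \<psi>g idx_notin by (auto simp: \<psi>_def)
    show "w = w'"
    proof (cases "w \<in> P")
      case True
      then have "w' \<in> P" "idx w = idx w'"
        using 1 w(3) by (auto simp: \<psi>_def)
      then show ?thesis
        using unique idx True by metis
    next
      case False
      then have "w \<in> g ` I" "w' \<in> g ` I"
        using 1 w by auto
      then show ?thesis
        using w(3) \<psi>g by auto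
    qed
  qed
  moreover have "card (P \<union> g ` I) = \<Delta>"
  proof -
    have "P \<inter> g ` I = {}"
      using g by blast
    then show ?thesis
      using card_Un_disjoint[OF \<open>finite P\<close>, of "g ` I"] \<open>finite I\<close> card_image[OF g(1)] I P by simp
  qed
  moreover have "\<psi> w < length Gs \<and> {v, w} \<in> uedges (Gs ! \<psi> w)" if w: "w \<in> P \<union> g ` I" for w
  proof (cases "w \<in> P")
    case True
    then show ?thesis
      using idx by (simp add: \<psi>_def)
  next
    case False
    then obtain i where i: "i \<in> I" "w = g i"
      using w by blast
    then have "i \<in> J" "g i \<in> A i"
      using g I by auto
    then show ?thesis
      using star_leaves_at(4)[OF J_at] i \<psi>g by (auto simp: A_def J_def)
  qed
  moreover have "v \<notin> P \<union> g ` I"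
  proof -
    have "g i \<noteq> v" if "i \<in> I" for i
      using g(2)[OF that] star_leaves_at(3)[OF J_at] that I by (auto simp: A_def)
    then show ?thesis
      using \<open>v \<notin> P\<close> by auto
  qed
  ultimately show ?thesis
    unfolding contains_rainbow_K1_iff using Gs \<open>finite P\<close> \<open>finite I\<close>
    by (intro exI[of _ Gs] exI[of _ v] exI[of _ "P \<union> g ` I"] exI[of _ \<psi>]) auto
qed

lemma rainbow_free_iff:
  "rainbow_free S (K1 \<Delta>) \<longleftrightarrow> (\<forall>v\<in>V. m v + indeg v \<le> \<Delta> - 1)"
proof -
  have "x \<le> \<Delta> - 1 \<longleftrightarrow> \<not> \<Delta> \<le> x" for x
    using Delta_ge by linarith
  then show ?thesis
    using rainbow_imp_degree degree_imp_rainbow by auto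
qed

end

subsection \<open>Constructions\<close>

lemma filter_mset_sum:
  assumes "finite I"
  shows "filter_mset P (\<Sum>i\<in>I. f i) = (\<Sum>i\<in>I. filter_mset P (f i))"
  using assms by (induction I rule: finite_induct) auto

text \<open>
  Take \<open>k u\<close> copies of the star with center \<open>u\<close> and leaf set \<open>N u\<close>. If \<open>k u = 0\<close> then \<open>u\<close> is no
  center of the collection, which only lowers the in-degrees.
\<close>

lemma rainbow_free_star_collection_exists:
  assumes "finite V" "2 \<le> \<Delta>" "C \<subseteq> V"
    and N: "\<And>u. u \<in> C \<Longrightarrow> N u \<subseteq> V - {u} \<and> card (N u) = \<Delta>"
    and deg: "\<And>v. v \<in> V \<Longrightarrow> card {u \<in> C. v \<in> N u} \<le> \<Delta> - 1"
  shows "\<exists>S \<in> rainbow_free_star_collections V \<Delta>.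
           size S + (\<Sum>v\<in>C. card {u \<in> C. v \<in> N u}) = card C * (\<Delta> - 1)"
proof -
  define k where "k u = \<Delta> - 1 - card {w \<in> C. u \<in> N w}" for u
  define S where "S = (\<Sum>u\<in>C. replicate_mset (k u) (star u (N u)))"
  have "finite C"
    using assms finite_subset by blast
  have set_S: "\<exists>u\<in>C. G = star u (N u)" if "G \<in># S" for G
    using that \<open>finite C\<close> by (auto simp: S_def set_mset_sum split: if_splits)
  have "S \<in> star_collections V \<Delta>"
  proof -
    have "star_on V \<Delta> (star u (N u))" if "u \<in> C" for u
      unfolding star_on_iff using N[OF that] assms that finite_subset[of "N u" V] by blast
    then show ?thesis
      using set_S by (force simp: star_collections_def)
  qed
  then interpret S: star_collection V \<Delta> S
    using assms by unfold_locales auto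
  have center: "is_center \<Delta> (star u (N u)) v \<longleftrightarrow> v = u" if "u \<in> C" for u v
    using is_center_star_iff[of u "N u" \<Delta> v] N[OF that] assms by blast
  have stars_at: "stars_at \<Delta> S v = (if v \<in> C then replicate_mset (k v) (star v (N v)) else {#})" for v
  proof -
    have "stars_at \<Delta> S v = (\<Sum>u\<in>C. if u = v then replicate_mset (k v) (star v (N v)) else {#})"
      unfolding stars_at_def S_def filter_mset_sum[OF \<open>finite C\<close>]
      by (rule sum.cong) (auto simp: center filter_mset_eq_conv)
    then show ?thesis
      using \<open>finite C\<close> by simp
  qed
  have "S.C \<subseteq> C"
    by (auto simp: centers_def stars_at split: if_splits)
  have size_S: "size S = (\<Sum>u\<in>C. k u)"
    using \<open>finite C\<close> unfolding S_def by (induction C rule: finite_induct) auto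
  have "rainbow_free S (K1 \<Delta>)"
    unfolding S.rainbow_free_iff
  proof
    fix v assume "v \<in> V"
    have "S.indeg v \<le> card {u \<in> C. v \<in> N u}"
    proof (rule card_mono)
      show "{u \<in> S.C. v \<in> S.Out u} \<subseteq> {u \<in> C. v \<in> N u}"
        using \<open>S.C \<subseteq> C\<close>
        by (auto simp: out_leaves_def stars_at doubleton_eq_iff split: if_splits)
    qed (use \<open>finite C\<close> in auto)
    moreover have "S.m v \<le> k v"
      by (simp add: stars_at)
    ultimately show "S.m v + S.indeg v \<le> \<Delta> - 1"
      using deg[OF \<open>v \<in> V\<close>] by (simp add: k_def)
  qed
  moreover have "size S + (\<Sum>v\<in>C. card {u \<in> C. v \<in> N u}) = (\<Sum>u\<in>C. \<Delta> - 1)"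
    unfolding size_S sum.distrib[symmetric]
  proof (rule sum.cong)
    fix v assume "v \<in> C"
    then show "k v + card {u \<in> C. v \<in> N u} = \<Delta> - 1"
      using deg[of v] assms(3) by (auto simp: k_def)
  qed simp
  ultimately show ?thesis
    using S.S by (intro bexI[of _ S]) (auto simp: rainbow_free_star_collections_def)
qed

subsection \<open>Bounds and extremal structure\<close>

context star_collection
begin

lemma indeg_eq_0:
  assumes "\<And>u. u \<in> C \<Longrightarrow> v \<notin> Out u"
  shows "indeg v = 0"
proof -
  have "{u \<in> C. v \<in> Out u} = {}"
    using assms by blast
  then show ?thesis
    by (simp only: card.empty)
qed

lemma out_sets:
  assumes "rainbow_free S (K1 \<Delta>)"
  shows "out_sets V C (\<lambda>u. m u) Out \<Delta>"
  using assms finite_V C_subset Out_subset card_Out Delta_ge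
  unfolding rainbow_free_iff by unfold_locales auto

lemma size_le:
  assumes "rainbow_free S (K1 \<Delta>)"
  shows "int (size S) \<le> int (card C) * (int \<Delta> - 1)"
    and "int (size S) \<le> int (card V) * (int \<Delta> - 1) - int (card C) * int \<Delta>"
    and "int (size S) \<le> int (card C) * (int (card (V - C)) - 1)"
  using out_sets.total_le[OF out_sets[OF assms]] unfolding size_eq by blast+

lemma floor_structure_iff:
  "floor_structure V \<Delta> a k1 S \<longleftrightarrow> card C = a * (\<Delta> - 1) + k1 \<and>
     (\<forall>u\<in>C. m u = \<Delta> - 1 \<and> Out u \<inter> C = {}) \<and> (\<forall>v\<in>V - C. indeg v \<le> \<Delta> - 1)"
proof -
  have "(\<forall>G \<in># stars_at \<Delta> S u. star_leaves G u \<subseteq> V - C) \<longleftrightarrow> Out u \<inter> C = {}" for u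
    using Out_subset[of u] leaves_subset_Out[of _ u] by (blast elim: mem_OutE)
  then show ?thesis
    unfolding floor_structure_def Let_def noncenters_def in_degree_star_digraph by simp
qed

lemma ceiling_structure_iff:
  "ceiling_structure V \<Delta> a k1 k2 S \<longleftrightarrow> card C = a * (\<Delta> - 1) + k1 + 1 \<and>
     (\<Sum>u\<in>C. int (card (Out u \<inter> C))) = 2 * int \<Delta> - 1 - int k2 \<and>
     (\<forall>u\<in>C. int (m u) = int \<Delta> - 1 - int (indeg u)) \<and> (\<forall>v\<in>V - C. indeg v = \<Delta> - 1)"
  unfolding ceiling_structure_def Let_def noncenters_def in_degree_star_digraph card_arcs_induced
  by simp

lemma small_structure_iff:
  "small_structure V \<Delta> S \<longleftrightarrow>
     (odd (card V) \<longrightarrow> int (card C) = \<lfloor>(real (card V) - 1) / 2\<rfloor>) \<and>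
     (even (card V) \<longrightarrow> int (card C) \<in> {\<lfloor>(real (card V) - 1) / 2\<rfloor>, \<lceil>(real (card V) - 1) / 2\<rceil>}) \<and>
     (\<forall>u\<in>C. int (card (Out u \<inter> C)) = int \<Delta> - int (card (V - C))) \<and>
     (\<forall>u\<in>C. int (m u) = int \<Delta> - 1 - int (indeg u) \<and>
        (\<forall>G \<in># stars_at \<Delta> S u. V - C \<subseteq> star_leaves G u))"
proof -
  have "verts (star_digraph V \<Delta> S \<restriction> C) = C"
    by simp
  then have "out_regular d (star_digraph V \<Delta> S \<restriction> C) \<longleftrightarrow> (\<forall>u\<in>C. int (card (Out u \<inter> C)) = d)" for d
    by (simp add: out_regular_def out_degree_induced)
  then show ?thesis
    unfolding small_structure_def Let_def noncenters_def in_degree_star_digraph by simp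
qed

lemma noncenters_subset_leaves:
  assumes "G \<in># stars_at \<Delta> S u" "int (card (Out u \<inter> C)) = int \<Delta> - int (card (V - C))"
  shows "V - C \<subseteq> star_leaves G u"
proof -
  let ?F = "star_leaves G u"
  have fin: "finite ?F" "finite (Out u)"
    using star_leaves_at(1)[OF assms(1)] Out_subset[of u] finite_V by (auto intro: finite_subset)
  have "card ?F = card (?F \<inter> C) + card (?F \<inter> (V - C))"
    using star_leaves_at(1,3)[OF assms(1)]
    by (subst card_Un_disjoint[symmetric]) (auto intro: arg_cong[where f = card])
  moreover have "card (?F \<inter> C) \<le> card (Out u \<inter> C)"
    using leaves_subset_Out[OF assms(1)] fin by (intro card_mono) auto
  ultimately have "card (V - C) \<le> card (?F \<inter> (V - C))"
    using assms(2) star_leaves_at(2)[OF assms(1)] by linarith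
  then have "?F \<inter> (V - C) = V - C"
    using finite_V by (intro card_seteq) auto
  then show ?thesis
    by blast
qed

lemma structure_imp_rainbow_free:
  assumes "floor_structure V \<Delta> a k1 S \<or> ceiling_structure V \<Delta> a k1 k2 S \<or>
    (small_structure V \<Delta> S \<and> card V \<le> 2 * \<Delta> - 2)"
  shows "rainbow_free S (K1 \<Delta>)"
  unfolding rainbow_free_iff
proof
  fix v assume v: "v \<in> V"
  consider "floor_structure V \<Delta> a k1 S" | "ceiling_structure V \<Delta> a k1 k2 S"
    | "small_structure V \<Delta> S" "card V \<le> 2 * \<Delta> - 2"
    using assms by blast
  then show "m v + indeg v \<le> \<Delta> - 1"
  proof cases
    case 1
    show ?thesis
    proof (cases "v \<in> C")
      case True
      then have "indeg v = 0"
        using 1 unfolding floor_structure_iff by (intro indeg_eq_0) blast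
      then show ?thesis
        using 1 True unfolding floor_structure_iff by simp
    next
      case False
      then show ?thesis
        using 1 v not_center unfolding floor_structure_iff by simp
    qed
  next
    case 2
    show ?thesis
    proof (cases "v \<in> C")
      case True
      then have "int (m v) = int \<Delta> - 1 - int (indeg v)"
        using 2 unfolding ceiling_structure_iff by blast
      then show ?thesis
        using Delta_ge by linarith
    next
      case False
      then show ?thesis
        using 2 v not_center unfolding ceiling_structure_iff by simp
    qed
  next
    case 3
    show ?thesis
    proof (cases "v \<in> C")
      case True
      then have "int (m v) = int \<Delta> - 1 - int (indeg v)"
        using 3 unfolding small_structure_iff by blast
      then show ?thesis
        using Delta_ge by linarith
    next
      case False
      have "int (card C) \<le> \<lceil>(real (card V) - 1) / 2\<rceil>"
        using 3(1) unfolding small_structure_iff by (metis floor_le_ceiling insertE order_refl singletonD)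
      then have "2 * card C \<le> card V"
        unfolding le_ceiling_iff by simp
      moreover have "indeg v \<le> card C"
        using finite_C by (intro card_mono) auto
      ultimately show ?thesis
        using False 3(2) Delta_ge not_center by simp
    qed
  qed
qed

lemma size_eq_imp_floor_structure:
  assumes "rainbow_free S (K1 \<Delta>)" "card C = a * (\<Delta> - 1) + k1" "size S = card C * (\<Delta> - 1)"
  shows "floor_structure V \<Delta> a k1 S"
proof -
  interpret O: out_sets V C "\<lambda>u. m u" Out \<Delta>
    by (rule out_sets[OF assms(1)])
  have "int (\<Sum>u\<in>C. m u) = int (card C) * (int \<Delta> - 1)"
    using assms(3) Delta_ge unfolding size_eq by (simp only: of_nat_mult of_nat_diff) simp
  from O.inner_bound_tight[OF this] show ?thesis
    unfolding floor_structure_iff using assms(1,2) unfolding rainbow_free_iff by fastforce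
qed

lemma size_eq_imp_ceiling_structure:
  assumes "rainbow_free S (K1 \<Delta>)" "card C = a * (\<Delta> - 1) + k1 + 1"
    and "size S + card C * \<Delta> = card V * (\<Delta> - 1)"
    and "card C * (2 * \<Delta> - 1) + k2 = card V * (\<Delta> - 1) + (2 * \<Delta> - 1)"
  shows "ceiling_structure V \<Delta> a k1 k2 S"
proof -
  interpret O: out_sets V C "\<lambda>u. m u" Out \<Delta>
    by (rule out_sets[OF assms(1)])
  have *: "int (\<Delta> - 1) = int \<Delta> - 1" "int (2 * \<Delta> - 1) = 2 * int \<Delta> - 1"
    using Delta_ge by auto
  have "int (\<Sum>u\<in>C. m u) + int (card C) * int \<Delta> = int (card V) * (int \<Delta> - 1)"
    using assms(3) unfolding size_eq by (metis * of_nat_add of_nat_mult)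
  then have total: "int (\<Sum>u\<in>C. m u) = int (card V) * (int \<Delta> - 1) - int (card C) * int \<Delta>"
    by simp
  have "int (card C) * (2 * int \<Delta> - 1) + int k2 = int (card V) * (int \<Delta> - 1) + (2 * int \<Delta> - 1)"
    using assms(4) by (metis * of_nat_add of_nat_mult)
  then show ?thesis
    unfolding ceiling_structure_iff using O.degree_bound_tight[OF total] assms(2) by auto
qed

end

lemma is_max_size_unique: "is_max_size V \<Delta> m \<Longrightarrow> is_max_size V \<Delta> m' \<longleftrightarrow> m' = m"
  by (auto simp: is_max_size_def intro: le_antisym)

lemma floor_or_ceiling_bound:
  fixes n c c0 k2 D T :: nat
  assumes "1 \<le> D" "T \<le> c * D" "T + c * (D + 1) \<le> n * D" "n * D = c0 * (2 * D + 1) + k2"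
  shows "(c = c0 \<and> T \<le> c0 * D) \<or> T < c0 * D \<or>
     (c = c0 + 1 \<and> T + (D + 1) \<le> c0 * D + k2) \<or> T + (D + 1) < c0 * D + k2"
proof (cases "c \<le> c0")
  case True
  then obtain j where "c0 = c + j"
    using le_Suc_ex by blast
  then show ?thesis
    using assms(1,2) by (cases j) (auto simp: algebra_simps)
next
  case False
  then obtain j where "c = c0 + 1 + j"
    by (metis Suc_eq_plus1 le_Suc_ex not_less_eq_eq)
  then show ?thesis
    using assms(1,3,4) by (cases j) (auto simp: algebra_simps)
qed

lemma quarter_square_bound:
  fixes x c T :: int
  assumes "T \<le> c * (x - c)"
  shows "T \<le> x\<^sup>2 div 4"
    and "T = x\<^sup>2 div 4 \<Longrightarrow> T = c * (x - c) \<and> (if even x then 2 * c = x else 2 * c \<in> {x - 1, x + 1})"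
proof -
  have sq: "4 * (c * (x - c)) = x\<^sup>2 - (x - 2 * c)\<^sup>2"
    by (simp add: power2_eq_square algebra_simps)
  then have le: "4 * (c * (x - c)) \<le> x\<^sup>2"
    by simp
  with assms show "T \<le> x\<^sup>2 div 4"
    by linarith
  assume T: "T = x\<^sup>2 div 4"
  then have eq: "T = c * (x - c)"
    using assms le by linarith
  then have "(x - 2 * c)\<^sup>2 < 2\<^sup>2"
    using sq T by simp
  then have "\<bar>x - 2 * c\<bar> < 2"
    using abs_le_square_iff[of 2 "x - 2 * c"] by linarith
  then have "2 * c \<in> {x - 1, x, x + 1}"
    by auto
  then show "T = c * (x - c) \<and> (if even x then 2 * c = x else 2 * c \<in> {x - 1, x + 1})"
    using eq by auto presburger+
qed

subsection \<open>Attaining the bounds\<close>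

lemma floor_collection_exists:
  fixes V :: "'a set"
  assumes "finite V" "1 \<le> D" "2 * D + 1 \<le> card V" "1 \<le> c"
    and eq: "card V * D = c * (2 * D + 1) + k2"
  shows "\<exists>S \<in> rainbow_free_star_collections V (D + 1). c * D \<le> size S"
proof -
  have "c * (2 * D + 1) \<le> card V * (2 * D + 1)"
    using eq by (simp add: algebra_simps)
  then have "c \<le> card V"
    unfolding mult_le_cancel2 by simp
  then obtain C where C: "C \<subseteq> V" "card C = c"
    by (meson obtain_subset_with_card_n)
  obtain l where l: "card V = c + l"
    using \<open>c \<le> card V\<close> le_Suc_ex by blast
  then have L: "card (V - C) = l"
    using C assms(1) by (simp add: card_Diff_subset finite_subset)
  have le: "c * (D + 1) \<le> l * D"
    using eq by (simp add: l algebra_simps)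
  have "D + 1 \<le> l"
  proof (rule ccontr)
    assume "\<not> D + 1 \<le> l"
    then have "l \<le> D" "D + 1 \<le> c"
      using assms(3) l by auto
    then have "l * D \<le> D * D" "(D + 1) * (D + 1) \<le> c * (D + 1)"
      by (blast intro: mult_le_mono1)+
    moreover have "(D + 1) * (D + 1) = D * D + 2 * D + 1"
      by simp
    ultimately show False
      using le by linarith
  qed
  then obtain N where N: "\<forall>u\<in>C. N u \<subseteq> V - {u} \<and> card (N u) = D + 1"
    "\<forall>v\<in>V. card {u \<in> C. v \<in> N u} \<le> D" "(\<Sum>v\<in>C. card {u \<in> C. v \<in> N u}) \<le> 0"
    using balanced_out_sets_exist[OF assms(1) C(1) assms(2), of 0] L C le assms(4) by auto
  have "\<exists>S \<in> rainbow_free_star_collections V (D + 1).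
      size S + (\<Sum>v\<in>C. card {u \<in> C. v \<in> N u}) = card C * (D + 1 - 1)"
    by (rule rainbow_free_star_collection_exists) (use N assms(1,2) C in simp_all)
  then obtain S where "S \<in> rainbow_free_star_collections V (D + 1)" "size S = c * D"
    using N(3) C(2) by auto
  then show ?thesis
    by (metis order_refl)
qed

lemma ceiling_collection_exists:
  fixes V :: "'a set"
  assumes "finite V" "D \<le> c0" "1 \<le> D" "2 * D + 1 \<le> card V" "D + 1 \<le> k2" "k2 \<le> 2 * D"
    and eq: "card V * D = c0 * (2 * D + 1) + k2"
  shows "\<exists>S \<in> rainbow_free_star_collections V (D + 1). c0 * D + k2 \<le> size S + (D + 1)"
proof -
  define c where "c = c0 + 1"
  define e where "e = 2 * D + 1 - k2"
  have e: "k2 + e = 2 * D + 1" "1 \<le> e" "e \<le> D"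
    using assms(5,6) by (auto simp: e_def)
  have c: "c * (2 * D + 1) = card V * D + e"
    using eq e(1) by (simp add: c_def algebra_simps)
  have "card V * D + e \<le> card V * (2 * D + 1)"
    using e(3) assms(3,4) by (simp add: algebra_simps)
  then have "c * (2 * D + 1) \<le> card V * (2 * D + 1)"
    using c by simp
  then have "c \<le> card V"
    unfolding mult_le_cancel2 by simp
  then obtain C where C: "C \<subseteq> V" "card C = c"
    by (meson obtain_subset_with_card_n)
  obtain l where l: "card V = c + l"
    using \<open>c \<le> card V\<close> le_Suc_ex by blast
  then have L: "card (V - C) = l"
    using C assms(1) by (simp add: card_Diff_subset finite_subset)
  have le: "c * (D + 1) = l * D + e"
    using c by (simp add: l algebra_simps)
  have "D + 1 \<le> l"
  proof (rule ccontr)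
    assume "\<not> D + 1 \<le> l"
    then have "l \<le> D" "D + 1 \<le> c"
      using assms(2) by (auto simp: c_def)
    then have "l * D \<le> D * D" "(D + 1) * (D + 1) \<le> c * (D + 1)"
      by (blast intro: mult_le_mono1)+
    moreover have "(D + 1) * (D + 1) = D * D + 2 * D + 1"
      by simp
    ultimately show False
      using le e by linarith
  qed
  then obtain N where N: "\<forall>u\<in>C. N u \<subseteq> V - {u} \<and> card (N u) = D + 1"
    "\<forall>v\<in>V. card {u \<in> C. v \<in> N u} \<le> D" "(\<Sum>v\<in>C. card {u \<in> C. v \<in> N u}) \<le> e"
    using balanced_out_sets_exist[OF assms(1) C(1) assms(3), of e] L C le e assms(2)
    by (auto simp: c_def)
  have "\<exists>S \<in> rainbow_free_star_collections V (D + 1).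
      size S + (\<Sum>v\<in>C. card {u \<in> C. v \<in> N u}) = card C * (D + 1 - 1)"
    by (rule rainbow_free_star_collection_exists) (use N assms(1,3) C in simp_all)
  then obtain S where "S \<in> rainbow_free_star_collections V (D + 1)"
    "size S + (\<Sum>v\<in>C. card {u \<in> C. v \<in> N u}) = c * D"
    using C(2) by auto
  moreover have "c0 * D + k2 + e = c * D + (D + 1)"
    using e(1) by (simp add: c_def)
  ultimately show ?thesis
    using N(3) by (intro bexI[of _ S]) linarith+
qed

text \<open>
  The centers are joined to all of \<open>L\<close>. Since \<open>|C| \<le> \<Delta> - 1\<close>, no in-degree can exceed \<open>\<Delta> - 1\<close>, so
  the remaining out-neighbors in \<open>C\<close> may be arbitrary.
\<close>

lemma small_collection_exists:
  fixes V :: "'a set"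
  assumes "finite V" "\<Delta> + 1 \<le> card V" "card V \<le> 2 * \<Delta> - 2"
  shows "\<exists>S \<in> rainbow_free_star_collections V \<Delta>. size S = (card V - 1)\<^sup>2 div 4"
proof -
  define c where "c = (card V - 1) div 2"
  define l where "l = card V - c"
  have cl: "1 \<le> c" "1 \<le> l" "c \<le> card V" "l \<le> \<Delta>" "\<Delta> - l \<le> c - 1" "c \<le> \<Delta> - 1" "2 \<le> \<Delta>" "\<Delta> - l \<le> \<Delta> - 1"
    using assms(2,3) by (auto simp: c_def l_def)
  obtain C where C: "C \<subseteq> V" "card C = c"
    using cl by (meson obtain_subset_with_card_n)
  have fin: "finite C" "finite (V - C)"
    using C assms(1) finite_subset by auto
  have L: "card (V - C) = l"
    using C fin by (simp add: card_Diff_subset l_def)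
  have "\<exists>X. X \<subseteq> C - {u} \<and> card X = \<Delta> - l" if "u \<in> C" for u
  proof -
    have "\<Delta> - l \<le> card (C - {u})"
      using cl that C fin by simp
    then show ?thesis
      by (meson obtain_subset_with_card_n)
  qed
  then obtain X where X: "\<And>u. u \<in> C \<Longrightarrow> X u \<subseteq> C - {u} \<and> card (X u) = \<Delta> - l"
    by metis
  define N where "N u = (V - C) \<union> X u" for u
  have "N u \<subseteq> V - {u} \<and> card (N u) = \<Delta>" if "u \<in> C" for u
  proof -
    have "finite (X u)" "(V - C) \<inter> X u = {}"
      using X[OF that] fin by (auto intro: finite_subset)
    then show ?thesis
      using X[OF that] C L fin that cl by (auto simp: N_def card_Un_disjoint)
  qed
  moreover have "card {u \<in> C. v \<in> N u} \<le> \<Delta> - 1" for v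
    using card_mono[of C "{u \<in> C. v \<in> N u}"] fin C cl by force
  ultimately obtain S where S: "S \<in> rainbow_free_star_collections V \<Delta>"
    "size S + (\<Sum>v\<in>C. card {u \<in> C. v \<in> N u}) = card C * (\<Delta> - 1)"
    using rainbow_free_star_collection_exists[of V \<Delta> C N] assms(1) cl C by auto
  have "N u \<inter> C = X u" if "u \<in> C" for u
    using X[OF that] by (auto simp: N_def)
  then have "(\<Sum>v\<in>C. card {u \<in> C. v \<in> N u}) = c * (\<Delta> - l)"
    unfolding sum_card_in_eq_sum_card_out[OF fin(1) fin(1)] using X C by simp
  then have "size S + c * (\<Delta> - l) = c * (\<Delta> - 1)"
    using S(2) C by simp
  moreover have "c * (\<Delta> - 1) = c * (\<Delta> - l) + c * (l - 1)"
    unfolding add_mult_distrib2[symmetric] using cl by simp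
  ultimately have "size S = c * (l - 1)"
    by simp
  also have "\<dots> = (card V - 1)\<^sup>2 div 4"
  proof -
    define q r where "q = (card V - 1) div 2" and "r = (card V - 1) mod 2"
    then have q: "card V - 1 = 2 * q + r" "r = 0 \<or> r = 1"
      by auto
    then have "c = q" "l - 1 = q + r"
      using cl by (auto simp: c_def l_def)
    then show ?thesis
      unfolding q(1) using q(2) by (auto simp: power2_eq_square algebra_simps)
  qed
  finally show ?thesis
    using S(1) by blast
qed

lemma rainbow_free_star_collections_1: "rainbow_free_star_collections V 1 = {{#}}"
proof (intro equalityI subsetI)
  fix S assume S: "S \<in> rainbow_free_star_collections V 1"
  have False if G_in: "G \<in># S" for G
  proof -
    have "star_on V 1 G"
      using S G_in by (auto simp: rainbow_free_star_collections_def star_collections_def)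
    then obtain u N where G: "G = star u N" "finite N" "u \<notin> N" "card N = 1"
      by (auto simp: star_on_iff)
    then obtain w where w: "N = {w}"
      by (auto simp: card_1_singleton_iff)
    obtain Gs where Gs: "mset Gs = S"
      using ex_mset by blast
    then have "G \<in> set Gs"
      using G_in by auto
    then obtain i where "i < length Gs" "Gs ! i = G"
      by (auto simp: in_set_conv_nth)
    then have "contains_rainbow S (K1 1)"
      unfolding contains_rainbow_K1_iff using G w Gs
      by (intro exI[of _ Gs] exI[of _ u] exI[of _ N] exI[of _ "\<lambda>_. i"]) auto
    then show False
      using S by (simp add: rainbow_free_star_collections_def)
  qed
  then show "S \<in> {{#}}"
    by (metis insertI1 multiset_nonemptyE)
next
  fix S :: "'a ugraph multiset" assume "S \<in> {{#}}"
  then show "S \<in> rainbow_free_star_collections V 1"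
    by (auto simp: rainbow_free_star_collections_def star_collections_def contains_rainbow_K1_iff)
qed

lemma extremal_of_bound:
  assumes ex: "\<exists>S \<in> rainbow_free_star_collections V \<Delta>. M \<le> size S"
    and bound: "\<And>S. S \<in> rainbow_free_star_collections V \<Delta> \<Longrightarrow> size S \<le> M \<and> (size S = M \<longrightarrow> P S)"
    and suff: "\<And>S. S \<in> star_collections V \<Delta> \<Longrightarrow> P S \<Longrightarrow> rainbow_free S (K1 \<Delta>)"
    and ext: "\<And>S. S \<in> extremal_collections V \<Delta> a k1 k2 \<longleftrightarrow> S \<in> star_collections V \<Delta> \<and> size S = M \<and> P S"
  shows "is_max_size V \<Delta> M \<and>
    {S \<in> rainbow_free_star_collections V \<Delta>. is_max_size V \<Delta> (size S)} = extremal_collections V \<Delta> a k1 k2"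
proof
  show max: "is_max_size V \<Delta> M"
    using ex bound unfolding is_max_size_def by (metis le_antisym)
  show "{S \<in> rainbow_free_star_collections V \<Delta>. is_max_size V \<Delta> (size S)} = extremal_collections V \<Delta> a k1 k2"
    unfolding is_max_size_unique[OF max] using bound suff
    by (auto simp: ext rainbow_free_star_collections_def)
qed

theorem theorem1p1:
  fixes V :: "'a set" and n \<Delta> a b k1 k2 :: nat
  assumes "\<Delta> \<ge> 1"
    and "finite V" and "card V = n" and "n \<ge> \<Delta> + 1"
    and "n = a * (2 * \<Delta> - 1) + b" and "b \<le> 2 * \<Delta> - 2"
    and "b * (\<Delta> - 1) = k1 * (2 * \<Delta> - 1) + k2" and "k2 \<le> 2 * \<Delta> - 2"
  shows "(a \<ge> 1 \<and> k2 \<le> \<Delta> \<longrightarrow>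
            is_max_size V \<Delta> (a * (\<Delta> - 1)^2 + k1 * (\<Delta> - 1))) \<and>
         (a \<ge> 1 \<and> \<Delta> \<le> k2 \<and> k2 \<le> 2 * \<Delta> - 2 \<longrightarrow>
            is_max_size V \<Delta> (a * (\<Delta> - 1)^2 + k1 * (\<Delta> - 1) + k2 - \<Delta>)) \<and>
         (a = 0 \<longrightarrow> is_max_size V \<Delta> ((n - 1)^2 div 4)) \<and>
         {\<S> \<in> rainbow_free_star_collections V \<Delta>. is_max_size V \<Delta> (size \<S>)}
           = extremal_collections V \<Delta> a k1 k2"
proof -
  consider "\<Delta> = 1" | "2 \<le> \<Delta>" "1 \<le> a" | "2 \<le> \<Delta>" "a = 0"
    using assms(1) by linarith
  then show ?thesis
  proof cases
    case 1
    have "k2 = 0" "k1 = 0" "b = 0" "a \<noteq> 0"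
      using assms(4-8) 1 by auto
    have max: "is_max_size V \<Delta> 0"
      unfolding is_max_size_def using rainbow_free_star_collections_1[of V] 1 by simp
    have "extremal_collections V \<Delta> a k1 k2 = {{#}}"
      using assms(3,4) 1 \<open>k2 = 0\<close> \<open>k1 = 0\<close>
      by (auto simp: extremal_collections_def star_collections_def floor_structure_def Let_def
          centers_def stars_at_def in_degree_def in_arcs_def star_digraph_def)
    moreover have "{\<S> \<in> rainbow_free_star_collections V \<Delta>. is_max_size V \<Delta> (size \<S>)} = {{#}}"
      unfolding is_max_size_unique[OF max] using rainbow_free_star_collections_1[of V] 1 by auto
    ultimately show ?thesis
      using max 1 \<open>a \<noteq> 0\<close> \<open>k1 = 0\<close> \<open>k2 = 0\<close> by simp
  next
    case 2
    define D where "D = \<Delta> - 1"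
    then have D: "\<Delta> = D + 1" "1 \<le> D"
      using 2(1) by auto
    define c0 where "c0 = a * D + k1"
    have D': "2 * \<Delta> - 1 = 2 * D + 1" "\<Delta> - 1 = D" "2 * \<Delta> - 2 = 2 * D"
      using D by auto
    have eq: "card V * D = c0 * (2 * D + 1) + k2"
      using assms(3,5,7) unfolding D' c0_def by (simp add: algebra_simps)
    have c0: "1 \<le> c0" "D \<le> c0"
      using 2 D by (auto simp: c0_def intro: trans_le_add1)
    have V: "2 * D + 1 \<le> card V"
      using assms(3,5) 2 unfolding D' by (metis le_add1 le_trans mult_le_mono1 mult_1)
    have k2: "k2 \<le> 2 * D"
      using assms(8) D' by simp
    have M0: "a * (\<Delta> - 1)^2 + k1 * (\<Delta> - 1) = c0 * D"
      unfolding D' c0_def by (simp add: power2_eq_square algebra_simps)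
    have star: "star_collection V \<Delta> S" if "S \<in> star_collections V \<Delta>" for S
      using that assms(2) 2 by unfold_locales
    define M where "M = (if k2 \<le> \<Delta> then c0 * D else c0 * D + k2 - \<Delta>)"
    define P where "P S \<longleftrightarrow> (k2 \<le> \<Delta> \<and> floor_structure V \<Delta> a k1 S) \<or>
      (\<Delta> \<le> k2 \<and> ceiling_structure V \<Delta> a k1 k2 S)" for S
    have "is_max_size V \<Delta> M \<and>
      {S \<in> rainbow_free_star_collections V \<Delta>. is_max_size V \<Delta> (size S)} = extremal_collections V \<Delta> a k1 k2"
    proof (rule extremal_of_bound[where P = P])
      show "\<exists>S \<in> rainbow_free_star_collections V \<Delta>. M \<le> size S"
      proof (cases "k2 \<le> \<Delta>")
        case True
        then show ?thesis
          using floor_collection_exists[OF assms(2) D(2) V c0(1) eq] D by (simp add: M_def)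
      next
        case False
        then obtain S where "S \<in> rainbow_free_star_collections V (D + 1)" "c0 * D + k2 \<le> size S + (D + 1)"
          using ceiling_collection_exists[OF assms(2) c0(2) D(2) V _ k2 eq] D by auto
        then show ?thesis
          using False D by (intro bexI[of _ S]) (auto simp: M_def)
      qed
      show "S \<in> extremal_collections V \<Delta> a k1 k2 \<longleftrightarrow> S \<in> star_collections V \<Delta> \<and> size S = M \<and> P S" for S
        using V D' unfolding extremal_collections_def M_def P_def M0
        by (cases k2 \<Delta> rule: linorder_cases) auto
      show "rainbow_free S (K1 \<Delta>)" if "S \<in> star_collections V \<Delta>" "P S" for S
        using star_collection.structure_imp_rainbow_free[OF star[OF that(1)]] that(2)
        unfolding P_def by blast
    next
      fix S assume S: "S \<in> rainbow_free_star_collections V \<Delta>"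
      then have rf: "rainbow_free S (K1 \<Delta>)" and "S \<in> star_collections V \<Delta>"
        by (auto simp: rainbow_free_star_collections_def)
      then interpret S: star_collection V \<Delta> S
        using star by blast
      have 1: "size S \<le> card S.C * D"
        using S.size_le(1)[OF rf] D by (simp flip: of_nat_mult)
      have "int (size S + card S.C * (D + 1)) \<le> int (card V * D)"
        using S.size_le(2)[OF rf] D by (simp add: algebra_simps)
      then have 2: "size S + card S.C * (D + 1) \<le> card V * D"
        by (simp only: of_nat_le_iff)
      note cases = floor_or_ceiling_bound[OF D(2) 1 2 eq]
      have "size S \<le> M"
        using cases k2 D by (auto simp: M_def)
      moreover have "P S" if M: "size S = M"
      proof -
        consider "card S.C = c0" "k2 \<le> \<Delta>" "size S = c0 * D"
          | "card S.C = c0 + 1" "\<Delta> \<le> k2" "size S + (D + 1) = c0 * D + k2"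
          using cases M D by (auto simp: M_def split: if_splits)
        then show ?thesis
        proof cases
          case 1
          then have "floor_structure V \<Delta> a k1 S"
            using D by (intro S.size_eq_imp_floor_structure[OF rf]) (auto simp: c0_def)
          then show ?thesis
            using 1 by (simp add: P_def)
        next
          case 2
          have "ceiling_structure V \<Delta> a k1 k2 S"
            by (rule S.size_eq_imp_ceiling_structure[OF rf]) (use 2 D D' eq in \<open>auto simp: c0_def algebra_simps\<close>)
          then show ?thesis
            using 2 by (simp add: P_def)
        qed
      qed
      ultimately show "size S \<le> M \<and> (size S = M \<longrightarrow> P S)"
        by blast
    qed
    moreover have "M = c0 * D + k2 - \<Delta>" if "\<Delta> \<le> k2"
      using that by (auto simp: M_def)
    ultimately show ?thesis
      using 2 unfolding M0 by (auto simp: M_def)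
  next
    case 3
    then have V: "\<Delta> + 1 \<le> card V" "card V \<le> 2 * \<Delta> - 2"
      using assms(3-6) by auto
    have star: "star_collection V \<Delta> S" if "S \<in> star_collections V \<Delta>" for S
      using that assms(2) 3 by unfold_locales
    have "is_max_size V \<Delta> ((card V - 1)\<^sup>2 div 4) \<and>
      {S \<in> rainbow_free_star_collections V \<Delta>. is_max_size V \<Delta> (size S)} = extremal_collections V \<Delta> a k1 k2"
    proof (rule extremal_of_bound[where P = "small_structure V \<Delta>"])
      show "\<exists>S \<in> rainbow_free_star_collections V \<Delta>. (card V - 1)\<^sup>2 div 4 \<le> size S"
        using small_collection_exists[OF assms(2) V] by (metis order_refl)
      show "S \<in> extremal_collections V \<Delta> a k1 k2 \<longleftrightarrow>
          S \<in> star_collections V \<Delta> \<and> size S = (card V - 1)\<^sup>2 div 4 \<and> small_structure V \<Delta> S" for S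
        using V 3 by (auto simp: extremal_collections_def)
      show "rainbow_free S (K1 \<Delta>)" if "S \<in> star_collections V \<Delta>" "small_structure V \<Delta> S" for S
        using star_collection.structure_imp_rainbow_free[OF star[OF that(1)]] that(2) V(2) by blast
    next
      fix S assume S: "S \<in> rainbow_free_star_collections V \<Delta>"
      then have rf: "rainbow_free S (K1 \<Delta>)" and "S \<in> star_collections V \<Delta>"
        by (auto simp: rainbow_free_star_collections_def)
      then interpret S: star_collection V \<Delta> S
        using star by blast
      interpret O: out_sets V S.C "\<lambda>u. S.m u" S.Out \<Delta>
        by (rule S.out_sets[OF rf])
      define x where "x = int (card V) - 1"
      have l: "O.l - 1 = x - O.c"
        using O.c_plus_l by (simp add: x_def)
      have le: "int (size S) \<le> O.c * (x - O.c)"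
        using S.size_le(3)[OF rf] l by simp
      have M: "int ((card V - 1)\<^sup>2 div 4) = x\<^sup>2 div 4"
        using V by (simp add: x_def zdiv_int of_nat_diff)
      have "size S \<le> (card V - 1)\<^sup>2 div 4"
        using quarter_square_bound(1)[OF le] M by linarith
      moreover have "small_structure V \<Delta> S" if "size S = (card V - 1)\<^sup>2 div 4"
      proof -
        have "int (size S) = x\<^sup>2 div 4"
          using that M by simp
        from quarter_square_bound(2)[OF le this]
        have eq: "O.total = O.c * (O.l - 1)"
          and c: "if even x then 2 * O.c = x else 2 * O.c \<in> {x - 1, x + 1}"
          using l S.size_eq by auto
        have "O.c = \<lfloor>(real (card V) - 1) / 2\<rfloor>" if "odd (card V)"
          using c that by (intro floor_unique[symmetric]) (auto simp: x_def)
        moreover have "O.c = \<lfloor>(real (card V) - 1) / 2\<rfloor> \<or> O.c = \<lceil>(real (card V) - 1) / 2\<rceil>"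
          if ev: "even (card V)"
        proof -
          consider "2 * O.c = int (card V) - 2" | "2 * O.c = int (card V)"
            using c ev by (auto simp: x_def split: if_splits)
          then show ?thesis
          proof cases
            case 1
            then have "real_of_int (2 * O.c) = real_of_int (int (card V) - 2)"
              by (rule arg_cong)
            then have "O.c = \<lfloor>(real (card V) - 1) / 2\<rfloor>"
              by (intro floor_unique[symmetric]) simp_all
            then show ?thesis ..
          next
            case 2
            then have "real_of_int (2 * O.c) = real_of_int (int (card V))"
              by (rule arg_cong)
            then have "O.c = \<lceil>(real (card V) - 1) / 2\<rceil>"
              by (intro ceiling_unique[symmetric]) simp_all
            then show ?thesis ..
          qed
        qed
        ultimately show ?thesis
          unfolding S.small_structure_iff
          using O.complete_bound_tight[OF eq] S.noncenters_subset_leaves by auto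
      qed
      ultimately show "size S \<le> (card V - 1)\<^sup>2 div 4 \<and>
          (size S = (card V - 1)\<^sup>2 div 4 \<longrightarrow> small_structure V \<Delta> S)"
        by blast
    qed
    then show ?thesis
      using 3 assms(3) by simp
  qed
qed

end
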